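(* Let $x\in\ell^2(\mathbb N)$ with non-negative entries, $T\ge0$ and $0<\varepsilon<1$. Suppose that: (i) $K\ge1$ is such that $\mathbb P(S(x,T)\ge K)\le\frac{\varepsilon}{100}$; (ii) $\varepsilon_1\in(0,\varepsilon)$ is such that $S(x_{\le\varepsilon_1},0)\le\dfrac{\varepsilon^2}{100(1+T+KT^2)}$; (iii) $\varepsilon_2\in(0,\varepsilon_1)$ is such that $S(x_{\le\varepsilon_2},0)\le\dfrac{2\varepsilon_1^2\varepsilon^2}{100(1+T(K+2))^2}$. Then with probability larger than $1-\varepsilon$, the following holds for any $t\le T$: (a) every component of $\mathcal{MG}(x,t)$ of size larger than $\varepsilon$ contains a component of $\mathcal{MG}(x,0)$ of size larger than $\varepsilon_1$; (b) no component of $\mathcal{MG}(x_{\le\varepsilon_1},0)$ is contained in a cycle in $\mathcal{MG}(x,t)$; (c) for each component $m$ of $\mathcal{MG}(x_{\le\varepsilon_1},t)$ and each component $m'$ of $\mathcal{MG}(x_{>\varepsilon_1},t)$, there is at most one edge between $m$ and $m'$ in $\mathcal{MG}(x,t)$; (d) $S(x,t)-S(x_{>\varepsilon_2},t)\le2\varepsilon_1^2$; (e) for any component $\{i\}$ of $\mathcal{MG}(x,0)$ of size larger than $\varepsilon_1$, the difference between the sizes of the component containing $i$ in $\mathcal{MG}(x,t)$ and the one containing $i$ in $\mathcal{MG}(x_{>\varepsilon_2},t)$ is less than $\varepsilon_1$.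
   Context: Let $(N_{i,j})$ be independent Poisson point processes on $\mathbb R^+$ with intensity $1$, indexed by ordered pairs of indices, and let $T_{i,j,n}$ be the $n$-th jump time of $N_{i,j}$. For a square-summable sequence $x$ of non-negative numbers and $t\ge0$, $\mathcal{MG}(x,t)$ is the weighted multigraph (with loops) whose vertices are the indices, vertex $i$ having weight $x_i$, with one edge between $i$ and $j$ for each $n$ such that $T_{i,j,n}\le\frac t2x_ix_j$ and one for each $n$ such that $T_{j,i,n}\le\frac t2x_ix_j$ (so the number of edges between $i\ne j$ is Poisson with mean $tx_ix_j$). The same processes $N_{i,j}$ are used for all $x$ and $t$. Cycles are understood in the multigraph sense (two parallel edges form a cycle). Components are connected components, and the size of a component is the sum of the weights of its vertices; at time $0$ the components are the singletons $\{i\}$, of size $x_i$. $S(x,t)$ is the sum of the squares of the sizes of the components of $\mathcal{MG}(x,t)$; in particular $S(x,0)=\sum_ix_i^2$. For $\varepsilon>0$, $x_{\le\varepsilon}$ is the sequence with entries $x_i\mathbf 1_{x_i\le\varepsilon}$ and $x_{>\varepsilon}$ the sequence with entries $x_i\mathbf 1_{x_i>\varepsilon}$. Vertices of weight $0$ have no edges and are disregarded, so $\mathcal{MG}(x_{\le\varepsilon},t)$ (resp. $\mathcal{MG}(x_{>\varepsilon},t)$) is the sub-multigraph of $\mathcal{MG}(x,t)$ induced by the vertices with $0<x_i\le\varepsilon$ (resp. $x_i>\varepsilon$). *)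

theory Defs
  imports "HOL-Probability.Probability"
begin

section \<open>Poisson point processes on the half-line\<close>

text \<open>
  A point configuration is a locally finite subset of the half-line. The origin is excluded, which
  is immaterial for the law of a Poisson process since the origin has Lebesgue measure zero. Only
  simple configurations (sets, not multisets) are considered, as a Poisson process with Lebesgue
  intensity has almost surely no multiple points.
\<close>

definition configurations :: "real set set" where
  "configurations = {A. A \<subseteq> {0<..} \<and> (\<forall>b. finite (A \<inter> {..b}))}"

definition bounded_borel :: "real set set" where
  "bounded_borel = {B. B \<in> sets borel \<and> bounded B \<and> B \<subseteq> {0<..}}"

text \<open>
  The usual \<open>\<sigma>\<close>-algebra on configurations, generated by the counting maps. For \<open>B\<close> bounded,
  \<open>A \<inter> B\<close> is finite, so \<open>card\<close> is the true number of points.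
\<close>

definition config_space :: "real set measure" where
  "config_space = sigma configurations
     {{A \<in> configurations. card (A \<inter> B) = k} | B k. B \<in> bounded_borel}"

definition poisson_point_process :: "'w measure \<Rightarrow> ('w \<Rightarrow> real set) \<Rightarrow> bool" where
  "poisson_point_process M X \<longleftrightarrow>
     X \<in> measurable M config_space \<and>
     (\<forall>B\<in>bounded_borel. \<forall>k::nat.
        measure M {\<omega> \<in> space M. card (X \<omega> \<inter> B) = k}
          = measure lborel B ^ k / fact k * exp (- measure lborel B)) \<and>
     (\<forall>(n::nat) (B :: nat \<Rightarrow> real set).
        (\<forall>k<n. B k \<in> bounded_borel) \<and> disjoint_family_on B {..<n} \<longrightarrow>
        prob_space.indep_vars M (\<lambda>_. count_space UNIV) (\<lambda>k \<omega>. card (X \<omega> \<inter> B k)) {..<n})"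

text \<open>
  The \<open>n\<close>-th jump time, for \<open>n \<ge> 1\<close>: the first time at which at least \<open>n\<close> points have been
  counted, and \<open>\<infinity>\<close> if there are fewer than \<open>n\<close> points in total.
\<close>

definition jump_time :: "real set \<Rightarrow> nat \<Rightarrow> ereal" where
  "jump_time A n = Inf {ereal s | s. n \<le> card (A \<inter> {..s})}"


section \<open>Weighted multigraphs\<close>

text \<open>
  Undirected: \<open>ends e\<close> is the set of end points of the edge \<open>e\<close>, a singleton if \<open>e\<close> is a loop.
\<close>

record ('v, 'e) wmultigraph =
  verts :: "'v set"
  edges :: "'e set"
  ends :: "'e \<Rightarrow> 'v set"
  weight :: "'v \<Rightarrow> real"

definition adj :: "('v, 'e) wmultigraph \<Rightarrow> ('v \<times> 'v) set" where
  "adj G = {(u, v). u \<in> verts G \<and> v \<in> verts G \<and> (\<exists>e\<in>edges G. ends G e = {u, v})}"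

definition component_of :: "('v, 'e) wmultigraph \<Rightarrow> 'v \<Rightarrow> 'v set" where
  "component_of G v = {w \<in> verts G. (v, w) \<in> (adj G)\<^sup>*}"

definition graph_components :: "('v, 'e) wmultigraph \<Rightarrow> 'v set set" where
  "graph_components G = component_of G ` verts G"

text \<open>The integrals with respect to counting measures are sums of non-negative terms.\<close>

definition comp_size :: "('v, 'e) wmultigraph \<Rightarrow> 'v set \<Rightarrow> ennreal" where
  "comp_size G C = (\<integral>\<^sup>+ v. ennreal (weight G v) \<partial>count_space C)"

definition sum_sq :: "('v, 'e) wmultigraph \<Rightarrow> ennreal" where
  "sum_sq G = (\<integral>\<^sup>+ C. (comp_size G C)\<^sup>2 \<partial>count_space (graph_components G))"

text \<open>
  Vertices \<open>v\<^sub>0, \<dots>, v\<^sub>k\<^sub>-\<^sub>1\<close> and edges \<open>e\<^sub>0, \<dots>, e\<^sub>k\<^sub>-\<^sub>1\<close>, without repetition, with \<open>e\<^sub>l\<close> joining \<open>v\<^sub>l\<close> to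
  \<open>v\<^sub>l\<^sub>+\<^sub>1\<close> modulo \<open>k\<close>, where \<open>k \<ge> 1\<close>. A loop is a cycle (\<open>k = 1\<close>), and so are two parallel edges
  (\<open>k = 2\<close>).
\<close>

definition is_cycle :: "('v, 'e) wmultigraph \<Rightarrow> 'v list \<Rightarrow> 'e list \<Rightarrow> bool" where
  "is_cycle G vs es \<longleftrightarrow>
     vs \<noteq> [] \<and> length es = length vs \<and> distinct vs \<and> distinct es \<and>
     set vs \<subseteq> verts G \<and> set es \<subseteq> edges G \<and>
     (\<forall>l<length vs. ends G (es ! l) = {vs ! l, vs ! (Suc l mod length vs)})"

definition joins :: "('v, 'e) wmultigraph \<Rightarrow> 'e \<Rightarrow> 'v set \<Rightarrow> 'v set \<Rightarrow> bool" where
  "joins G e A B \<longleftrightarrow> e \<in> edges G \<and> (\<exists>u\<in>A. \<exists>v\<in>B. ends G e = {u, v})"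


section \<open>The multiplicative multigraph\<close>

text \<open>
  \<open>N (i, j) \<omega>\<close> is the configuration attached to the ordered pair \<open>(i, j)\<close>, and the edge coming from
  its \<open>n\<close>-th jump is \<open>(i, j, n)\<close>. So the edges between \<open>i\<close> and \<open>j\<close> are those of the form \<open>(i, j, n)\<close>
  and those of the form \<open>(j, i, n)\<close>; vertices of weight 0 are disregarded.
\<close>

definition MG ::
  "(nat \<times> nat \<Rightarrow> 'w \<Rightarrow> real set) \<Rightarrow> 'w \<Rightarrow> (nat \<Rightarrow> real) \<Rightarrow> real \<Rightarrow> (nat, nat \<times> nat \<times> nat) wmultigraph"
  where
  "MG N \<omega> x t = \<lparr>
     verts = {i. 0 < x i},
     edges = {(i, j, n). 0 < x i \<and> 0 < x j \<and> 1 \<le> n \<and>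
                jump_time (N (i, j) \<omega>) n \<le> ereal (t / 2 * x i * x j)},
     ends = (\<lambda>(i, j, n). {i, j}),
     weight = x\<rparr>"

definition trunc_le :: "real \<Rightarrow> (nat \<Rightarrow> real) \<Rightarrow> nat \<Rightarrow> real" where
  "trunc_le \<epsilon> x i = (if x i \<le> \<epsilon> then x i else 0)"

definition trunc_gt :: "real \<Rightarrow> (nat \<Rightarrow> real) \<Rightarrow> nat \<Rightarrow> real" where
  "trunc_gt \<epsilon> x i = (if x i > \<epsilon> then x i else 0)"


section \<open>The multigraph at time zero\<close>

lemma jump_time_le_iff:
  assumes A: "A \<in> configurations" and n: "1 \<le> n"
  shows "jump_time A n \<le> ereal s \<longleftrightarrow> n \<le> card (A \<inter> {..s})"
proof
  assume "n \<le> card (A \<inter> {..s})"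
  then show "jump_time A n \<le> ereal s"
    unfolding jump_time_def by (intro Inf_lower) auto
next
  assume le: "jump_time A n \<le> ereal s"
  show "n \<le> card (A \<inter> {..s})"
  proof (rule ccontr)
    assume neg: "\<not> n \<le> card (A \<inter> {..s})"
    have fin: "finite (A \<inter> {..b})" for b
      using A by (auto simp: configurations_def)
    define F where "F = A \<inter> {s<..s + 1}"
    have finF: "finite F"
      by (rule finite_subset[OF _ fin[of "s + 1"]]) (auto simp: F_def)
    define s' where "s' = (if F = {} then s + 1 else Min F)"
    have s': "s < s'"
      using finF by (auto simp: s'_def F_def)
    have "ereal s' \<le> jump_time A n"
      unfolding jump_time_def
    proof (rule Inf_greatest, clarify)
      fix r assume r: "n \<le> card (A \<inter> {..r})"
      show "ereal s' \<le> ereal r"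
      proof (rule ccontr)
        assume "\<not> ereal s' \<le> ereal r"
        then have "r < s'" by simp
        have "s' \<le> s + 1"
          using finF Min_in[OF finF] by (auto simp: s'_def F_def)
        have "A \<inter> {..r} \<subseteq> A \<inter> {..s}"
        proof
          fix a assume a: "a \<in> A \<inter> {..r}"
          show "a \<in> A \<inter> {..s}"
          proof (rule ccontr)
            assume "a \<notin> A \<inter> {..s}"
            then have "a \<in> F"
              using a \<open>r < s'\<close> \<open>s' \<le> s + 1\<close> by (auto simp: F_def)
            then have "s' \<le> a"
              using finF by (auto simp: s'_def)
            then show False using a \<open>r < s'\<close> by auto
          qed
        qed
        then have "card (A \<inter> {..r}) \<le> card (A \<inter> {..s})"
          by (intro card_mono fin)
        then show False using r neg by simp
      qed
    qed
    then have "ereal s' \<le> ereal s" using le by (rule order_trans)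
    then show False using s' by simp
  qed
qed

lemma graph_components_MG_0:
  assumes "\<And>p. N p \<omega> \<in> configurations"
  shows "graph_components (MG N \<omega> x 0) = (\<lambda>i. {i}) ` {i. 0 < x i}"
proof -
  have "\<not> jump_time (N p \<omega>) n \<le> 0" if "1 \<le> n" for p n
  proof -
    have "N p \<omega> \<inter> {..0} = {}"
      using assms[of p] by (auto simp: configurations_def)
    then show ?thesis
      using jump_time_le_iff[OF assms that, of p 0] that by (simp add: zero_ereal_def)
  qed
  then have "edges (MG N \<omega> x 0) = {}"
    by (auto simp: MG_def simp flip: zero_ereal_def)
  then have "adj (MG N \<omega> x 0) = {}"
    by (auto simp: adj_def)
  then show ?thesis
    by (auto simp: graph_components_def component_of_def MG_def)
qed

lemma sum_sq_MG_0:
  assumes "\<And>p. N p \<omega> \<in> configurations" and "\<And>i. 0 \<le> x i" and "summable (\<lambda>i. (x i)\<^sup>2)"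
  shows "sum_sq (MG N \<omega> x 0) = ennreal (\<Sum>i. (x i)\<^sup>2)"
proof -
  have "sum_sq (MG N \<omega> x 0) = (\<integral>\<^sup>+ i. (comp_size (MG N \<omega> x 0) {i})\<^sup>2 \<partial>count_space {i. 0 < x i})"
    unfolding sum_sq_def graph_components_MG_0[of N \<omega> x, OF assms(1)]
    by (intro nn_integral_bij_count_space[symmetric]) (auto simp: bij_betw_def inj_on_def)
  also have "\<dots> = (\<integral>\<^sup>+ i. ennreal ((x i)\<^sup>2) \<partial>count_space {i. 0 < x i})"
    by (intro nn_integral_cong)
      (simp add: comp_size_def MG_def nn_integral_count_space_finite ennreal_power)
  also have "\<dots> = (\<integral>\<^sup>+ i. ennreal ((x i)\<^sup>2) \<partial>count_space UNIV)"
    using assms(2)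
    by (intro nn_integral_count_space_eq) (auto simp: order.order_iff_strict)
  also have "\<dots> = ennreal (\<Sum>i. (x i)\<^sup>2)"
    by (simp add: nn_integral_count_space_nat suminf_ennreal_eq[OF _ summable_sums[OF assms(3)]])
  finally show ?thesis .
qed

end

theory Submission
  imports Defs "HOL-Library.Transitive_Closure_Table"
begin

text \<open>
  Everything is controlled by the edge counts at time \<open>T\<close>, since the graphs increase with \<open>t\<close>.
  Call a vertex small if its weight is at most \<open>\<epsilon>\<^sub>1\<close> and tiny if it is at most \<open>\<epsilon>\<^sub>2\<close>. The edges at a
  vertex \<open>k\<close> are independent of the graph with \<open>k\<close> deleted, and two distinct edges from \<open>k\<close> to \<open>u\<close>
  and \<open>v\<close> are both present with probability at most \<open>T\<^sup>2 x\<^sub>k\<^sup>2 x\<^sub>u x\<^sub>v\<close>. Summing over \<open>u\<close>, \<open>v\<close> that are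
  connected outside \<open>k\<close>, on the event \<open>S(x,T) < K\<close> the vertex \<open>k\<close> lies on a cycle of length at least 2
  with probability at most \<open>T\<^sup>2 K x\<^sub>k\<^sup>2\<close>; together with the loops this gives (b), and (c) is a
  consequence, because two edges between \<open>m\<close> and \<open>m'\<close> close a cycle through a small vertex.

  For (d), two vertices that are connected only with the help of tiny vertices are joined by a simple
  path through some tiny \<open>k\<close>. The same decomposition at \<open>k\<close> bounds the expected contribution of \<open>k\<close>
  by \<open>x\<^sub>k\<^sup>2 (1 + T K)\<^sup>2\<close>, and this quantity is monotone in \<open>t\<close>, unlike the difference in (d). The pairs
  \<open>(i, j)\<close> and \<open>(j, i)\<close> with \<open>i\<close> fixed contribute twice \<open>x\<^sub>i\<close> times the difference in (e).

  For (a), a component of size larger than \<open>\<epsilon>\<close> made of small vertices has many pairs of distinct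
  vertices. Peeling off one vertex gives \<open>E S \<le> s + T s E S\<close> for the graph on finitely many small
  vertices, where \<open>s\<close> is the sum of their squared weights; here \<open>T s\<close> is small, so that \<open>E S \<le> 2 s\<close> and
  the distinct pairs contribute at most \<open>2 T s\<^sup>2\<close>.
\<close>

section \<open>Series of non-negative extended reals\<close>

lemma suminf_ennreal_swap:
  fixes f :: "nat \<Rightarrow> nat \<Rightarrow> ennreal"
  shows "(\<Sum>i. \<Sum>j. f i j) = (\<Sum>j. \<Sum>i. f i j)"
  using nn_integral_suminf[of "\<lambda>j i. f i j" "count_space UNIV"]
  by (simp add: nn_integral_count_space_nat)

lemma suminf_ennreal_ge_term: "f i \<le> (\<Sum>i. f i :: ennreal)"
  using sum_le_suminf[of f "{i}"] by (simp add: summableI)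

lemma suminf_ennreal_single: "(\<Sum>i. f i * of_bool (i = a)) = (f a :: ennreal)"
  by (subst suminf_finite[of "{a}"]) auto

lemma suminf_ennreal_add: "(\<Sum>i. f i + g i :: ennreal) = (\<Sum>i. f i) + (\<Sum>i. g i)"
  by (rule suminf_add[symmetric]) auto

lemma suminf_ennreal_mono: "(\<And>i. f i \<le> (g i :: ennreal)) \<Longrightarrow> (\<Sum>i. f i) \<le> (\<Sum>i. g i)"
  by (intro suminf_le) auto

section \<open>Connectivity in terms of edge counts\<close>

text \<open>
  The count \<open>f (i, j)\<close> is the number of edges \<open>(i, j, n)\<close>, so that \<open>i\<close> and \<open>j\<close> are joined by
  \<open>f (i, j) + f (j, i)\<close> edges if \<open>i \<noteq> j\<close>.
\<close>

definition edge :: "(nat \<times> nat \<Rightarrow> nat) \<Rightarrow> nat \<Rightarrow> nat \<Rightarrow> bool" where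
  "edge f u v \<longleftrightarrow> 0 < f (u, v) \<or> 0 < f (v, u)"

text \<open>Membership of the end points is required separately because the reflexive closure
  relates every vertex to itself, even outside \<open>A\<close>.\<close>

definition con :: "nat set \<Rightarrow> (nat \<times> nat \<Rightarrow> nat) \<Rightarrow> nat \<Rightarrow> nat \<Rightarrow> bool" where
  "con A f i j \<longleftrightarrow> i \<in> A \<and> j \<in> A \<and> (\<lambda>u v. u \<in> A \<and> v \<in> A \<and> edge f u v)\<^sup>*\<^sup>* i j"

definition csize :: "(nat \<Rightarrow> ennreal) \<Rightarrow> nat set \<Rightarrow> (nat \<times> nat \<Rightarrow> nat) \<Rightarrow> nat \<Rightarrow> ennreal" where
  "csize w A f i = (\<Sum>j. w j * of_bool (con A f i j))"

text \<open>This is the sum of the squared component sizes of the graph on \<open>A\<close>, written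
  over ordered connected pairs so that the pairs can be treated one at a time.\<close>

definition susc :: "(nat \<Rightarrow> ennreal) \<Rightarrow> nat set \<Rightarrow> (nat \<times> nat \<Rightarrow> nat) \<Rightarrow> ennreal" where
  "susc w A f = (\<Sum>i. w i * csize w A f i)"

text \<open>Meant for \<open>u\<close> and \<open>v\<close> different from \<open>k\<close>: there
  are two distinct edges at \<open>k\<close>, one to \<open>u\<close> and one to \<open>v\<close>.
  If \<open>u = v\<close> they are parallel, and both orientations count.\<close>

definition two_edges :: "(nat \<times> nat \<Rightarrow> nat) \<Rightarrow> nat \<Rightarrow> nat \<Rightarrow> nat \<Rightarrow> bool" where
  "two_edges f k u v \<longleftrightarrow> (if u = v then 2 \<le> f (k, u) + f (u, k) else edge f k u \<and> edge f k v)"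

lemma edge_sym: "edge f u v \<longleftrightarrow> edge f v u"
  by (auto simp: edge_def)

lemma edge_mono: "edge f u v \<Longrightarrow> f \<le> g \<Longrightarrow> edge g u v"
  unfolding edge_def le_fun_def by (metis less_le_trans)

lemma two_edges_mono:
  assumes "two_edges f k u v" "f \<le> g"
  shows "two_edges g k u v"
proof -
  have "f p \<le> g p" for p using assms(2) by (rule le_funD)
  from this[of "(k, u)"] this[of "(u, k)"] show ?thesis
    using assms edge_mono[of f _ _ g] by (auto simp: two_edges_def split: if_splits)
qed

lemma con_refl: "i \<in> A \<Longrightarrow> con A f i i"
  by (simp add: con_def)

lemma con_in: "con A f i j \<Longrightarrow> i \<in> A" "con A f i j \<Longrightarrow> j \<in> A"
  by (auto simp: con_def)

lemma con_edge: "i \<in> A \<Longrightarrow> j \<in> A \<Longrightarrow> edge f i j \<Longrightarrow> con A f i j"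
  by (auto simp: con_def)

lemma con_trans: "con A f i j \<Longrightarrow> con A f j k \<Longrightarrow> con A f i k"
  by (auto simp: con_def)

lemma con_sym: "con A f i j \<Longrightarrow> con A f j i"
  unfolding con_def
  by (auto intro!: sympD[OF symp_rtranclp] sympI simp: edge_sym)

lemma con_mono:
  assumes "con A f i j" "A \<subseteq> B" "f \<le> g"
  shows "con B g i j"
proof -
  have "(\<lambda>u v. u \<in> B \<and> v \<in> B \<and> edge g u v)\<^sup>*\<^sup>* i j"
    by (rule rtranclp_mono[THEN predicate2D, of "\<lambda>u v. u \<in> A \<and> v \<in> A \<and> edge f u v"])
      (use assms edge_mono[of f _ _ g] in \<open>auto simp: con_def\<close>)
  then show ?thesis using assms by (auto simp: con_def)
qed

text \<open>A path from \<open>i\<close> visits only vertices of the component of \<open>i\<close>,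
  so it survives in any set containing that component. This is why the induction carries the
  connection in \<open>A\<close> along.\<close>

lemma con_restrict:
  assumes "con A f i j" "\<And>v. con A f i v \<Longrightarrow> v \<in> B"
  shows "con B f i j"
proof -
  have "(\<lambda>u v. u \<in> A \<and> v \<in> A \<and> edge f u v)\<^sup>*\<^sup>* i j" "i \<in> A" using assms(1) by (auto simp: con_def)
  then have "con A f i j \<and> con B f i j"
  proof (induction rule: rtranclp_induct)
    case base
    then show ?case using assms(2)[OF con_refl] by (auto intro: con_refl)
  next
    case (step y z)
    then have "con A f i z" using con_trans[of A f i y z] con_edge[of y A z f] by blast
    have "con B f y z"
      using step assms(2)[OF \<open>con A f i z\<close>] by (auto intro: con_edge dest: con_in)
    then show ?case using step \<open>con A f i z\<close> con_trans by blast
  qed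
  then show ?thesis by simp
qed

text \<open>Only the part of a path after its last visit to \<open>i\<close> matters, and that part
  avoids \<open>i\<close>.\<close>

lemma con_first_step:
  assumes "con A f i j" "i \<noteq> j"
  obtains u where "edge f i u" "con (A - {i}) f u j"
proof -
  have "(\<lambda>u v. u \<in> A \<and> v \<in> A \<and> edge f u v)\<^sup>*\<^sup>* i j" using assms(1) by (simp add: con_def)
  then have "i \<noteq> j \<longrightarrow> (\<exists>u. edge f i u \<and> con (A - {i}) f u j)"
  proof (induction rule: rtranclp_induct)
    case (step y z)
    show ?case
    proof (cases "y = i")
      case True
      \<comment> \<open>The path is back at \<open>i\<close>, so \<open>z\<close> becomes the new
        first neighbour.\<close>
      then show ?thesis using step con_refl[of z "A - {i}" f] by blast
    next
      case False
      then obtain u where u: "edge f i u" "con (A - {i}) f u y" using step by auto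
      show ?thesis
      proof
        assume "i \<noteq> z"
        then have "con (A - {i}) f y z" using step False by (intro con_edge) auto
        then show "\<exists>u. edge f i u \<and> con (A - {i}) f u z" using u con_trans by blast
      qed
    qed
  qed simp
  then show ?thesis using assms that by auto
qed

text \<open>A path has finitely many vertices; this allows an infinite graph to be exhausted by
  finite ones.\<close>

lemma con_finite:
  assumes "con A f i j"
  shows "\<exists>n. con (A \<inter> {..<n}) f i j"
proof -
  have "(\<lambda>u v. u \<in> A \<and> v \<in> A \<and> edge f u v)\<^sup>*\<^sup>* i j" "i \<in> A" using assms by (auto simp: con_def)
  then show ?thesis
  proof (induction rule: rtranclp_induct)
    case base
    then show ?case by (intro exI[of _ "Suc i"] con_refl) auto
  next
    case (step y z)
    then obtain n where n: "con (A \<inter> {..<n}) f i y" by auto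
    define m where "m = max n (Suc (max y z))"
    have "con (A \<inter> {..<m}) f i y" using n by (rule con_mono) (auto simp: m_def)
    moreover have "con (A \<inter> {..<m}) f y z" using step by (intro con_edge) (auto simp: m_def)
    ultimately show ?case using con_trans by blast
  qed
qed

lemma rtrancl_path_con:
  assumes "rtrancl_path (\<lambda>u v. u \<in> A \<and> v \<in> A \<and> edge f u v) i xs j" "i \<in> A" "k \<notin> set (i # xs)"
  shows "con (A - {k}) f i j"
  using assms
proof (induction rule: rtrancl_path.induct)
  case (base x)
  then show ?case by (auto intro: con_refl)
next
  case (step x y ys z)
  then have "con (A - {k}) f x y" by (intro con_edge) auto
  then show ?case using step by (auto intro: con_trans)
qed

text \<open>A path from \<open>i\<close> to \<open>j\<close> without repeated vertices must visit
  some \<open>k\<close> outside \<open>B\<close>, since otherwise it would connect them in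
  \<open>B\<close>. Cutting it at \<open>k\<close> leaves two pieces avoiding \<open>k\<close>. If
  \<open>k\<close> is neither end point, its two neighbours on the path are distinct, so two
  distinct edges at \<open>k\<close> are used.\<close>

lemma con_through:
  assumes "con A f i j" "\<not> con B f i j" "B \<subseteq> A"
  obtains k where "k \<in> A - B" "i = k \<or> (\<exists>u. edge f k u \<and> con (A - {k}) f u i)"
    "j = k \<or> (\<exists>v. edge f k v \<and> con (A - {k}) f v j)"
    "i \<noteq> k \<Longrightarrow> j \<noteq> k \<Longrightarrow> \<exists>u v. u \<noteq> v \<and> edge f k u \<and> edge f k v \<and> con (A - {k}) f u i \<and> con (A - {k}) f v j"
proof -
  let ?r = "\<lambda>u v. u \<in> A \<and> v \<in> A \<and> edge f u v"
  have iA: "i \<in> A" and jA: "j \<in> A" using assms con_in by auto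
  have "?r\<^sup>*\<^sup>* i j" using assms(1) by (auto simp: con_def)
  then obtain xs0 where "rtrancl_path ?r i xs0 j" by (auto simp: rtranclp_eq_rtrancl_path)
  then obtain xs where xs: "rtrancl_path ?r i xs j" and d: "distinct (i # xs)"
    by (rule rtrancl_path_distinct)
  have "\<exists>k\<in>set (i # xs). k \<notin> B"
  proof (rule ccontr)
    assume "\<not> ?thesis"
    moreover from xs have "set (i # xs) \<subseteq> B \<Longrightarrow> con B f i j"
      by induction (auto intro: con_refl con_edge con_trans)
    ultimately show False using assms by blast
  qed
  then obtain k where k: "k \<in> set (i # xs)" "k \<notin> B" by auto
  have inA: "set (i # xs) \<subseteq> A"
    using xs iA by induction auto
  \<comment> \<open>The piece after \<open>k\<close>. Recording that \<open>v\<close> lies on it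
    later separates \<open>v\<close> from \<open>u\<close>, which lies before
    \<open>k\<close>.\<close>
  have *: "\<exists>v. edge f k v \<and> con (A - {k}) f v j \<and> v \<in> set ys"
    if "rtrancl_path ?r k ys j" "distinct (k # ys)" "k \<noteq> j" for ys
    using that
  proof cases
    case (step y ys')
    then have "con (A - {k}) f y j" using that by (intro rtrancl_path_con) auto
    then show ?thesis using step by auto
  qed simp
  show ?thesis
  proof (cases "k = i")
    case True
    then have "j = k \<or> (\<exists>v. edge f k v \<and> con (A - {k}) f v j)" using *[of xs] xs d by auto
    with True k inA that show ?thesis by auto
  next
    case False
    then have "k \<in> set xs" using k by auto
    then obtain ys zs where xsd: "xs = ys @ k # zs" by (meson split_list)
    from xs have p1: "rtrancl_path ?r i (ys @ [k]) k" and p2: "rtrancl_path ?r k zs j"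
      unfolding xsd by (auto elim: rtrancl_path_appendE)
    obtain u where u: "edge f k u" "con (A - {k}) f u i" "u \<in> set (i # ys)"
    proof (cases ys rule: rev_cases)
      case Nil
      then have "edge f i k" using p1 by (auto elim: rtrancl_path.cases)
      then show ?thesis using that[of i] iA False by (auto simp: edge_sym intro: con_refl)
    next
      case (snoc ys' u)
      then have "rtrancl_path ?r i (ys' @ u # [k]) k" using p1 by simp
      then have q: "rtrancl_path ?r i (ys' @ [u]) u" "rtrancl_path ?r u [k] k"
        by (auto elim: rtrancl_path_appendE)
      have "edge f u k" using q(2) by (auto elim: rtrancl_path.cases)
      moreover have "con (A - {k}) f i u"
        using q(1) iA d False by (intro rtrancl_path_con) (auto simp: xsd snoc)
      ultimately show ?thesis using that[of u] snoc by (auto simp: edge_sym intro: con_sym)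
    qed
    show ?thesis
    proof (cases "j = k")
      case True
      then show ?thesis using that k inA u False by blast
    next
      case jk: False
      obtain v where v: "edge f k v" "con (A - {k}) f v j" "v \<in> set zs"
        using *[OF p2] d jk by (auto simp: xsd)
      have "u \<noteq> v" using u v d by (auto simp: xsd)
      then show ?thesis using that[of k] k inA u v by blast
    qed
  qed
qed

section \<open>Component sizes and the pairs lost by deleting vertices\<close>

lemma csize_mono: "A \<subseteq> B \<Longrightarrow> f \<le> g \<Longrightarrow> csize w A f i \<le> csize w B g i"
  unfolding csize_def by (intro suminf_ennreal_mono mult_left_mono) (auto intro: con_mono)

lemma susc_mono: "A \<subseteq> B \<Longrightarrow> f \<le> g \<Longrightarrow> susc w A f \<le> susc w B g"
  unfolding susc_def by (intro suminf_ennreal_mono mult_left_mono csize_mono) auto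

lemma csize_outside: "i \<notin> A \<Longrightarrow> csize w A f i = 0"
  by (simp add: csize_def con_def)

lemma csize_cong_con:
  assumes "con A f i j" shows "csize w A f i = csize w A f j"
  unfolding csize_def using con_trans[OF assms] con_trans[OF con_sym[OF assms]]
  by (intro arg_cong[where f = suminf] ext arg_cong2[where f = "(*)"]) (auto simp: of_bool_def)

text \<open>The ordered pairs inside the component of \<open>i\<close> alone contribute the square
  of its size.\<close>

lemma csize_square_le_susc: "(csize w A f i)\<^sup>2 \<le> susc w A f"
proof -
  have "(csize w A f i)\<^sup>2 = (\<Sum>j. w j * of_bool (con A f i j) * csize w A f i)"
    by (simp add: power2_eq_square csize_def)
  also have "\<dots> \<le> susc w A f"
    unfolding susc_def
    by (intro suminf_ennreal_mono) (auto simp: of_bool_def dest: csize_cong_con[of _ _ _ _ w])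
  finally show ?thesis .
qed

text \<open>
  An upper bound for the indicator of the existence of a simple path from \<open>i\<close> to \<open>j\<close> through \<open>k\<close>,
  written as a sum over the edges at \<open>k\<close> so that expectations can be taken term by term.
\<close>

definition through :: "nat set \<Rightarrow> (nat \<times> nat \<Rightarrow> nat) \<Rightarrow> nat \<Rightarrow> nat \<Rightarrow> nat \<Rightarrow> ennreal" where
  "through A f k i j =
     of_bool (i = k) * of_bool (j = k)
     + of_bool (i = k) * (\<Sum>u. of_bool (edge f k u) * of_bool (con (A - {k}) f u j))
     + of_bool (j = k) * (\<Sum>u. of_bool (edge f k u) * of_bool (con (A - {k}) f u i))
     + (\<Sum>u. \<Sum>v. of_bool (two_edges f k u v)
          * (of_bool (con (A - {k}) f u i) * of_bool (con (A - {k}) f v j)))"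

definition through_sum :: "(nat \<Rightarrow> ennreal) \<Rightarrow> nat set \<Rightarrow> (nat \<times> nat \<Rightarrow> nat) \<Rightarrow> nat \<Rightarrow> ennreal" where
  "through_sum w A f k = (\<Sum>i. \<Sum>j. w i * (w j * through A f k i j))"

lemma through_mono: "f \<le> g \<Longrightarrow> through A f k i j \<le> through A g k i j"
  unfolding through_def
  by (intro add_mono mult_mono suminf_ennreal_mono)
    (auto simp: of_bool_def intro: edge_mono two_edges_mono con_mono)

lemma through_sum_mono: "f \<le> g \<Longrightarrow> through_sum w A f k \<le> through_sum w A g k"
  unfolding through_sum_def
  by (intro suminf_ennreal_mono mult_left_mono through_mono) auto

text \<open>The four summands of \<open>through\<close> correspond to the four positions of
  \<open>i\<close> and \<open>j\<close> relative to the vertex \<open>k\<close> found by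
  \<open>con_through\<close>. In the last case \<open>u \<noteq> v\<close> turns the two edges into
  \<open>two_edges\<close>.\<close>

lemma one_le_through:
  assumes "con A f i j" "\<not> con B f i j" "B \<subseteq> A"
  obtains k where "k \<in> A - B" "1 \<le> through A f k i j"
proof -
  obtain k where k: "k \<in> A - B" "i = k \<or> (\<exists>u. edge f k u \<and> con (A - {k}) f u i)"
    "j = k \<or> (\<exists>v. edge f k v \<and> con (A - {k}) f v j)"
    "i \<noteq> k \<Longrightarrow> j \<noteq> k \<Longrightarrow> \<exists>u v. u \<noteq> v \<and> edge f k u \<and> edge f k v \<and> con (A - {k}) f u i \<and> con (A - {k}) f v j"
    using con_through[OF assms] by blast
  have single: "1 \<le> (\<Sum>u. of_bool (edge f k u) * of_bool (con (A - {k}) f u j) :: ennreal)"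
    if "edge f k v" "con (A - {k}) f v j" for v j
    using suminf_ennreal_ge_term[of "\<lambda>u. of_bool (edge f k u) * of_bool (con (A - {k}) f u j)" v] that
    by simp
  consider "i = k" "j = k" | "i = k" "j \<noteq> k" | "i \<noteq> k" "j = k" | "i \<noteq> k" "j \<noteq> k" by blast
  then have "1 \<le> through A f k i j"
  proof cases
    case 1
    then show ?thesis by (simp add: through_def add.assoc)
  next
    case 2
    then obtain v where "edge f k v" "con (A - {k}) f v j" using k by auto
    from single[OF this] 2 show ?thesis
      by (simp add: through_def add_increasing2)
  next
    case 3
    then obtain v where "edge f k v" "con (A - {k}) f v i" using k by auto
    from single[OF this] 3 show ?thesis
      by (simp add: through_def add_increasing2)
  next
    case 4
    then obtain u v where uv: "u \<noteq> v" "edge f k u" "edge f k v" "con (A - {k}) f u i" "con (A - {k}) f v j"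
      using k(4) by blast
    let ?t = "\<lambda>u v. of_bool (two_edges f k u v)
          * (of_bool (con (A - {k}) f u i) * of_bool (con (A - {k}) f v j)) :: ennreal"
    have "1 = ?t u v" using uv by (simp add: two_edges_def)
    also have "\<dots> \<le> (\<Sum>v. ?t u v)" by (rule suminf_ennreal_ge_term)
    also have "\<dots> \<le> (\<Sum>u. \<Sum>v. ?t u v)" by (rule suminf_ennreal_ge_term)
    also have "\<dots> \<le> through A f k i j" by (simp add: through_def)
    finally show ?thesis .
  qed
  with k(1) show ?thesis by (rule that)
qed

text \<open>A union bound: every pair connected in \<open>A\<close> but not in \<open>B\<close> is
  charged to a deleted vertex on a path between them. The additive form avoids subtracting infinite
  quantities.\<close>

lemma susc_le_susc_plus:
  assumes "B \<subseteq> A"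
  shows "susc w A f \<le> susc w B f + (\<Sum>k. of_bool (k \<in> A - B) * through_sum w A f k)"
proof -
  have pt: "w i * (w j * of_bool (con A f i j)) \<le> w i * (w j * of_bool (con B f i j))
      + (\<Sum>k. of_bool (k \<in> A - B) * (w i * (w j * through A f k i j)))" for i j
  proof (cases "con A f i j \<and> \<not> con B f i j")
    case True
    then obtain k where k: "k \<in> A - B" "1 \<le> through A f k i j"
      using one_le_through assms by blast
    have "w i * (w j * 1) \<le> w i * (w j * through A f k i j)"
      using k by (intro mult_left_mono) auto
    also have "\<dots> = of_bool (k \<in> A - B) * (w i * (w j * through A f k i j))"
      using k by simp
    also have "\<dots> \<le> (\<Sum>k. of_bool (k \<in> A - B) * (w i * (w j * through A f k i j)))"
      by (rule suminf_ennreal_ge_term)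
    finally show ?thesis using True by simp
  qed (auto simp: of_bool_def)
  have "susc w A f = (\<Sum>i. \<Sum>j. w i * (w j * of_bool (con A f i j)))"
    by (simp add: susc_def csize_def)
  also have "\<dots> \<le> (\<Sum>i. \<Sum>j. w i * (w j * of_bool (con B f i j))
      + (\<Sum>k. of_bool (k \<in> A - B) * (w i * (w j * through A f k i j))))"
    by (intro suminf_ennreal_mono pt)
  also have "\<dots> = susc w B f
      + (\<Sum>i. \<Sum>j. \<Sum>k. of_bool (k \<in> A - B) * (w i * (w j * through A f k i j)))"
    by (simp add: suminf_ennreal_add susc_def csize_def)
  also have "(\<Sum>i. \<Sum>j. \<Sum>k. of_bool (k \<in> A - B) * (w i * (w j * through A f k i j)))
      = (\<Sum>i. \<Sum>k. \<Sum>j. of_bool (k \<in> A - B) * (w i * (w j * through A f k i j)))"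
    by (subst suminf_ennreal_swap) simp
  also have "\<dots> = (\<Sum>k. \<Sum>i. \<Sum>j. of_bool (k \<in> A - B) * (w i * (w j * through A f k i j)))"
    by (rule suminf_ennreal_swap)
  also have "\<dots> = (\<Sum>k. of_bool (k \<in> A - B) * through_sum w A f k)"
    by (simp add: through_sum_def)
  finally show ?thesis .
qed

text \<open>Here \<open>d\<close> is the weight that the component of \<open>i\<close> loses when
  \<open>A\<close> shrinks to \<open>B\<close>. A lost vertex \<open>j\<close> gives two lost
  ordered pairs, which explains the factor 2.\<close>

lemma csize_le_csize_plus:
  assumes "B \<subseteq> A" "i \<in> B"
  obtains d where "csize w A f i \<le> csize w B f i + d"
    and "2 * w i * d \<le> (\<Sum>k. of_bool (k \<in> A - B) * through_sum w A f k)"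
proof -
  define d where "d = (\<Sum>j. w j * of_bool (con A f i j \<and> \<not> con B f i j))"
  define P where "P a b = (\<Sum>k. of_bool (k \<in> A - B) * through A f k a b)" for a b
  have P: "1 \<le> P a b" if ab: "con A f a b" "\<not> con B f a b" for a b
  proof -
    obtain k where k: "k \<in> A - B" "1 \<le> through A f k a b"
      using one_le_through[OF ab assms(1)] by blast
    have "of_bool (k \<in> A - B) * through A f k a b \<le> P a b"
      unfolding P_def by (rule suminf_ennreal_ge_term)
    with k show ?thesis by auto
  qed
  \<comment> \<open>The two indicators are never both 1: that would force \<open>a = b = i\<close>,
    but \<open>i\<close> stays connected to itself in \<open>B\<close>. Hence one path through a
    deleted vertex pays for the whole sum.\<close>
  have P': "of_bool (a = i) * of_bool (con A f i b \<and> \<not> con B f i b)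
      + of_bool (b = i) * of_bool (con A f i a \<and> \<not> con B f i a) \<le> P a b" for a b
  proof -
    have "con B f i i" using assms by (simp add: con_refl)
    then show ?thesis
      using P[of a b] con_sym[of A f i a] con_sym[of B f a i]
      by (auto simp: of_bool_def)
  qed
  have "2 * w i * d = (\<Sum>a. \<Sum>b. w a * (w b * (of_bool (a = i) * of_bool (con A f i b \<and> \<not> con B f i b))))
      + (\<Sum>b. \<Sum>a. w a * (w b * (of_bool (b = i) * of_bool (con A f i a \<and> \<not> con B f i a))))"
  proof -
    have "w i * d = (\<Sum>a. (w a * d) * of_bool (a = i))" by (rule suminf_ennreal_single[symmetric])
    moreover have "(\<Sum>b. w a * (w b * (of_bool (a = i) * of_bool (con A f i b \<and> \<not> con B f i b))))
        = (w a * d) * of_bool (a = i)" for a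
      by (simp add: d_def)
    moreover have "(\<Sum>a. w a * (w b * (of_bool (b = i) * of_bool (con A f i a \<and> \<not> con B f i a))))
        = (w b * d) * of_bool (b = i)" for b
      by (simp add: d_def mult.left_commute[of _ "w b"])
    ultimately show ?thesis by (simp add: mult_2 distrib_right)
  qed
  also have "\<dots> = (\<Sum>a. \<Sum>b. w a * (w b * (of_bool (a = i) * of_bool (con A f i b \<and> \<not> con B f i b)
      + of_bool (b = i) * of_bool (con A f i a \<and> \<not> con B f i a))))"
    by (subst (2) suminf_ennreal_swap) (simp add: suminf_ennreal_add distrib_left)
  also have "\<dots> \<le> (\<Sum>a. \<Sum>b. w a * (w b * P a b))"
    by (intro suminf_ennreal_mono mult_left_mono P') auto
  also have "\<dots> = (\<Sum>a. \<Sum>b. \<Sum>k. of_bool (k \<in> A - B) * (w a * (w b * through A f k a b)))"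
    by (simp only: P_def ennreal_suminf_cmult[symmetric] mult.left_commute[of "w _" "of_bool _"])
  also have "\<dots> = (\<Sum>a. \<Sum>k. \<Sum>b. of_bool (k \<in> A - B) * (w a * (w b * through A f k a b)))"
    by (subst suminf_ennreal_swap) simp
  also have "\<dots> = (\<Sum>k. \<Sum>a. \<Sum>b. of_bool (k \<in> A - B) * (w a * (w b * through A f k a b)))"
    by (rule suminf_ennreal_swap)
  also have "\<dots> = (\<Sum>k. of_bool (k \<in> A - B) * through_sum w A f k)"
    by (simp add: through_sum_def)
  finally have 1: "2 * w i * d \<le> (\<Sum>k. of_bool (k \<in> A - B) * through_sum w A f k)" .
  have "csize w A f i \<le> (\<Sum>j. w j * of_bool (con B f i j) + w j * of_bool (con A f i j \<and> \<not> con B f i j))"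
    unfolding csize_def by (intro suminf_ennreal_mono) (auto simp: of_bool_def)
  also have "\<dots> = csize w B f i + d" by (simp add: suminf_ennreal_add csize_def d_def)
  finally show ?thesis using 1 that by blast
qed

text \<open>Summing over the end points turns the connection indicators into component sizes of the
  graph without \<open>k\<close>; the cases \<open>i = k\<close> and \<open>j = k\<close> give equal
  terms. In each term the edges at \<open>k\<close> and the rest of the graph now sit in separate
  factors, ready for independence.\<close>

lemma through_sum_eq:
  "through_sum w A f k = (w k)\<^sup>2
     + 2 * w k * (\<Sum>u. of_bool (edge f k u) * csize w (A - {k}) f u)
     + (\<Sum>u. \<Sum>v. of_bool (two_edges f k u v) * (csize w (A - {k}) f u * csize w (A - {k}) f v))"
proof -
  let ?c = "con (A - {k}) f" and ?C = "csize w (A - {k}) f"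
  have swap: "(\<Sum>j. w j * (\<Sum>u. of_bool (edge f k u) * of_bool (?c u j))) = (\<Sum>u. of_bool (edge f k u) * ?C u)"
  proof -
    have "(\<Sum>j. w j * (\<Sum>u. of_bool (edge f k u) * of_bool (?c u j)))
        = (\<Sum>j. \<Sum>u. of_bool (edge f k u) * (w j * of_bool (?c u j)))"
      by (simp only: ennreal_suminf_cmult[symmetric] mult.left_commute[of "w _" "of_bool _"])
    also have "\<dots> = (\<Sum>u. \<Sum>j. of_bool (edge f k u) * (w j * of_bool (?c u j)))"
      by (rule suminf_ennreal_swap)
    finally show ?thesis by (simp add: csize_def)
  qed
  have "through_sum w A f k =
     (\<Sum>i. \<Sum>j. w i * (w j * (of_bool (i = k) * of_bool (j = k))))
     + (\<Sum>i. \<Sum>j. w i * (w j * (of_bool (i = k) * (\<Sum>u. of_bool (edge f k u) * of_bool (?c u j)))))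
     + (\<Sum>i. \<Sum>j. w i * (w j * (of_bool (j = k) * (\<Sum>u. of_bool (edge f k u) * of_bool (?c u i)))))
     + (\<Sum>i. \<Sum>j. w i * (w j * (\<Sum>u. \<Sum>v. of_bool (two_edges f k u v) * (of_bool (?c u i) * of_bool (?c v j)))))"
    by (simp add: through_sum_def through_def distrib_left suminf_ennreal_add)
  also have "(\<Sum>i. \<Sum>j. w i * (w j * (of_bool (i = k) * of_bool (j = k)))) = (w k)\<^sup>2"
  proof -
    have "(\<Sum>j. w i * (w j * (of_bool (i = k) * of_bool (j = k)))) = w i * w k * of_bool (i = k)" for i
      using suminf_ennreal_single[of "\<lambda>j. w i * w j * of_bool (i = k)" k] by (simp add: mult_ac)
    then show ?thesis using suminf_ennreal_single[of "\<lambda>i. w i * w k" k] by (simp add: power2_eq_square)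
  qed
  also have "(\<Sum>i. \<Sum>j. w i * (w j * (of_bool (i = k) * (\<Sum>u. of_bool (edge f k u) * of_bool (?c u j)))))
      = w k * (\<Sum>u. of_bool (edge f k u) * ?C u)"
  proof -
    have "(\<Sum>j. w i * (w j * (of_bool (i = k) * (\<Sum>u. of_bool (edge f k u) * of_bool (?c u j)))))
       = w i * (\<Sum>u. of_bool (edge f k u) * ?C u) * of_bool (i = k)" for i
      unfolding swap[symmetric] by (simp add: mult.left_commute[of _ "of_bool (i = k)"] mult.commute[of _ "of_bool (i = k)"])
    then show ?thesis using suminf_ennreal_single[of "\<lambda>i. w i * (\<Sum>u. of_bool (edge f k u) * ?C u)" k] by simp
  qed
  also have "(\<Sum>i. \<Sum>j. w i * (w j * (of_bool (j = k) * (\<Sum>u. of_bool (edge f k u) * of_bool (?c u i)))))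
      = w k * (\<Sum>u. of_bool (edge f k u) * ?C u)"
  proof -
    have "(\<Sum>j. w i * (w j * (of_bool (j = k) * (\<Sum>u. of_bool (edge f k u) * of_bool (?c u i)))))
       = w k * (w i * (\<Sum>u. of_bool (edge f k u) * of_bool (?c u i)))" for i
      using suminf_ennreal_single[of "\<lambda>j. w j * (w i * (\<Sum>u. of_bool (edge f k u) * of_bool (?c u i)))" k]
      by (simp add: mult_ac)
    then show ?thesis by (simp add: swap)
  qed
  also have "(\<Sum>i. \<Sum>j. w i * (w j * (\<Sum>u. \<Sum>v. of_bool (two_edges f k u v) * (of_bool (?c u i) * of_bool (?c v j)))))
      = (\<Sum>u. \<Sum>v. of_bool (two_edges f k u v) * (?C u * ?C v))" (is "?L = ?R")
  proof -
    let ?t = "\<lambda>i j u v. of_bool (two_edges f k u v) * ((w i * of_bool (?c u i)) * (w j * of_bool (?c v j)))"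
    have "?L = (\<Sum>i. \<Sum>j. \<Sum>u. \<Sum>v. ?t i j u v)"
      by (simp only: ennreal_suminf_cmult[symmetric] mult_ac)
    also have "\<dots> = (\<Sum>i. \<Sum>u. \<Sum>j. \<Sum>v. ?t i j u v)"
      by (subst suminf_ennreal_swap) simp
    also have "\<dots> = (\<Sum>u. \<Sum>i. \<Sum>j. \<Sum>v. ?t i j u v)"
      by (rule suminf_ennreal_swap)
    also have "\<dots> = (\<Sum>u. \<Sum>i. \<Sum>v. \<Sum>j. ?t i j u v)"
      by (subst (2) suminf_ennreal_swap) simp
    also have "\<dots> = (\<Sum>u. \<Sum>v. \<Sum>i. \<Sum>j. ?t i j u v)"
      by (subst (1) suminf_ennreal_swap) simp
    also have "\<dots> = ?R" by (simp add: csize_def mult.commute)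
    finally show ?thesis .
  qed
  finally show ?thesis by (simp add: mult_2 distrib_right add.assoc)
qed


section \<open>Random edge counts\<close>

abbreviation counts :: "(nat \<times> nat) set \<Rightarrow> (nat \<times> nat \<Rightarrow> nat) measure" where
  "counts I \<equiv> PiM I (\<lambda>_. count_space UNIV)"

text \<open>These are the counts of all edges at \<open>k\<close>, in both orientations and
  including loops. The graph with \<open>k\<close> deleted reads only the counts outside
  \<open>star k\<close>.\<close>

definition star :: "nat \<Rightarrow> (nat \<times> nat) set" where
  "star k = {p. fst p = k \<or> snd p = k}"

section \<open>Measurability and locality in the edge counts\<close>

lemma measurable_of_bool_pred [measurable (raw)]:
  "Measurable.pred N P \<Longrightarrow> (\<lambda>x. of_bool (P x) :: ennreal) \<in> borel_measurable N"
  by (rule measurable_compose[OF _ measurable_of_bool])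

lemma pred_edge:
  assumes "(u, v) \<in> I" "(v, u) \<in> I"
  shows "Measurable.pred (counts I) (\<lambda>f. edge f u v)"
proof -
  have [measurable]: "(\<lambda>f. f (u, v)) \<in> measurable (counts I) (count_space UNIV)"
    "(\<lambda>f. f (v, u)) \<in> measurable (counts I) (count_space UNIV)"
    using assms by (auto intro: measurable_component_singleton)
  show ?thesis unfolding edge_def by measurable
qed

lemma pred_two_edges:
  assumes "star k \<subseteq> I"
  shows "Measurable.pred (counts I) (\<lambda>f. two_edges f k u v)"
proof -
  have I: "(k, i) \<in> I" "(i, k) \<in> I" for i
    using assms by (auto simp: star_def)
  have [measurable]: "(\<lambda>f. f (k, u)) \<in> borel_measurable (counts I)"
    "(\<lambda>f. f (u, k)) \<in> borel_measurable (counts I)"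
    using measurable_component_singleton[OF I(1)[of u], of "\<lambda>_. count_space UNIV"]
      measurable_component_singleton[OF I(2)[of u], of "\<lambda>_. count_space UNIV"]
    by (auto intro: measurable_compose[of _ _ "count_space UNIV"])
  have "Measurable.pred (counts I) (\<lambda>f. 2 \<le> f (k, u) + f (u, k))"
    by measurable
  moreover have "Measurable.pred (counts I) (\<lambda>f. edge f k u \<and> edge f k v)"
    by (intro pred_intros_logic pred_edge I)
  ultimately show ?thesis unfolding two_edges_def by (cases "u = v") simp_all
qed

text \<open>Splitting by path length makes reachability a countable union of events whose
  measurability follows by induction on the length.\<close>

lemma con_iff_relpowp:
  "con A f i j \<longleftrightarrow> i \<in> A \<and> j \<in> A \<and> (\<exists>n. ((\<lambda>u v. u \<in> A \<and> v \<in> A \<and> edge f u v) ^^ n) i j)"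
  by (simp add: con_def rtranclp_power)

lemma pred_con:
  assumes "A \<times> A \<subseteq> I"
  shows "Measurable.pred (counts I) (\<lambda>f. con A f i j)"
proof -
  have e: "Measurable.pred (counts I) (\<lambda>f. u \<in> A \<and> v \<in> A \<and> edge f u v)" for u v
  proof (cases "u \<in> A \<and> v \<in> A")
    case True
    then show ?thesis using assms by (auto intro!: pred_edge)
  next
    case False
    then have "(\<lambda>f. u \<in> A \<and> v \<in> A \<and> edge f u v) = (\<lambda>f. False)" by auto
    then show ?thesis by simp
  qed
  have [measurable]: "Measurable.pred (counts I)
      (\<lambda>f. ((\<lambda>u v. u \<in> A \<and> v \<in> A \<and> edge f u v) ^^ n) i j)" for n i j
  proof (induction n arbitrary: j)
    case (Suc n)
    note [measurable] = Suc e
    show ?case by (simp add: relcompp_apply) measurable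
  qed simp
  show ?thesis unfolding con_iff_relpowp by measurable
qed

lemma measurable_csize:
  assumes "A \<times> A \<subseteq> I"
  shows "(\<lambda>f. csize w A f i) \<in> borel_measurable (counts I)"
proof -
  note [measurable] = pred_con[OF assms]
  show ?thesis unfolding csize_def by measurable
qed

lemma measurable_susc:
  assumes "A \<times> A \<subseteq> I"
  shows "susc w A \<in> borel_measurable (counts I)"
proof -
  note [measurable] = measurable_csize[OF assms]
  have "(\<lambda>f. susc w A f) \<in> borel_measurable (counts I)" unfolding susc_def by measurable
  then show ?thesis .
qed

lemma measurable_through_sum: "(\<lambda>f. through_sum w A f k) \<in> borel_measurable (counts UNIV)"
proof -
  note [measurable] = pred_con pred_two_edges pred_edge
  show ?thesis unfolding through_sum_def through_def by measurable
qed

lemma con_cong: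
  assumes "\<And>p. p \<in> A \<times> A \<Longrightarrow> f p = g p"
  shows "con A f i j = con A g i j"
proof -
  have "(\<lambda>u v. u \<in> A \<and> v \<in> A \<and> edge f u v) = (\<lambda>u v. u \<in> A \<and> v \<in> A \<and> edge g u v)"
    using assms by (auto simp: edge_def fun_eq_iff)
  then show ?thesis by (simp add: con_def)
qed

lemma csize_cong: "(\<And>p. p \<in> A \<times> A \<Longrightarrow> f p = g p) \<Longrightarrow> csize w A f i = csize w A g i"
  unfolding csize_def using con_cong[of A f g] by simp

lemma susc_cong: "(\<And>p. p \<in> A \<times> A \<Longrightarrow> f p = g p) \<Longrightarrow> susc w A f = susc w A g"
  unfolding susc_def using csize_cong[of A f g] by simp

section \<open>Diagonal and off-diagonal part of the susceptibility\<close>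

definition off_diag :: "(nat \<Rightarrow> ennreal) \<Rightarrow> nat set \<Rightarrow> (nat \<times> nat \<Rightarrow> nat) \<Rightarrow> ennreal" where
  "off_diag w A f = (\<Sum>i. \<Sum>j. w i * (w j * of_bool (con A f i j \<and> i \<noteq> j)))"

text \<open>The value of \<open>susc\<close> in the absence of edges, that is, S at time 0.\<close>

definition sq_sum :: "(nat \<Rightarrow> ennreal) \<Rightarrow> nat set \<Rightarrow> ennreal" where
  "sq_sum w A = (\<Sum>i. of_bool (i \<in> A) * (w i)\<^sup>2)"

lemma measurable_off_diag: "off_diag w A \<in> borel_measurable (counts UNIV)"
proof -
  note [measurable] = pred_con
  have "(\<lambda>f. off_diag w A f) \<in> borel_measurable (counts UNIV)" unfolding off_diag_def by measurable
  then show ?thesis .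
qed

lemma susc_eq: "susc w A f = sq_sum w A + off_diag w A f"
proof -
  have "w i * (w j * of_bool (con A f i j))
      = (of_bool (i \<in> A) * w i * w j) * of_bool (j = i) + w i * (w j * of_bool (con A f i j \<and> i \<noteq> j))" for i j
    by (auto simp: of_bool_def con_refl dest: con_in)
  then have "susc w A f = (\<Sum>i. (\<Sum>j. (of_bool (i \<in> A) * w i * w j) * of_bool (j = i))
      + (\<Sum>j. w i * (w j * of_bool (con A f i j \<and> i \<noteq> j))))"
    unfolding susc_def csize_def
    by (simp only: ennreal_suminf_cmult[symmetric] suminf_ennreal_add)
  then show ?thesis
    unfolding suminf_ennreal_single by (simp add: suminf_ennreal_add sq_sum_def off_diag_def power2_eq_square mult.assoc)
qed

lemma sq_sum_mono: "A \<subseteq> B \<Longrightarrow> sq_sum w A \<le> sq_sum w B"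
  unfolding sq_sum_def by (intro suminf_ennreal_mono mult_right_mono) auto

text \<open>Peeling off \<open>i\<close>: a path from \<open>i\<close> to another vertex leaves by
  an edge to some \<open>u\<close> and need not return, so its end point is counted in the component
  of \<open>u\<close> with \<open>i\<close> deleted.\<close>

lemma off_diag_le_edges:
  "off_diag w A f \<le> (\<Sum>i. of_bool (i \<in> A) * w i * (\<Sum>u. of_bool (edge f i u) * csize w (A - {i}) f u))"
proof -
  have "(\<Sum>j. w i * (w j * of_bool (con A f i j \<and> i \<noteq> j)))
      \<le> of_bool (i \<in> A) * w i * (\<Sum>u. of_bool (edge f i u) * csize w (A - {i}) f u)" for i
  proof (cases "i \<in> A")
    case True
    have "of_bool (con A f i j \<and> i \<noteq> j) \<le> (\<Sum>u. of_bool (edge f i u) * of_bool (con (A - {i}) f u j) :: ennreal)" for j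
    proof (cases "con A f i j \<and> i \<noteq> j")
      case True
      then obtain u where "edge f i u" "con (A - {i}) f u j" using con_first_step by blast
      then show ?thesis
        using True suminf_ennreal_ge_term[of "\<lambda>u. of_bool (edge f i u) * of_bool (con (A - {i}) f u j)" u] by simp
    qed auto
    then have "(\<Sum>j. w i * (w j * of_bool (con A f i j \<and> i \<noteq> j)))
       \<le> (\<Sum>j. w i * (w j * (\<Sum>u. of_bool (edge f i u) * of_bool (con (A - {i}) f u j))))"
      by (intro suminf_ennreal_mono mult_left_mono) auto
    also have "\<dots> = w i * (\<Sum>j. \<Sum>u. of_bool (edge f i u) * (w j * of_bool (con (A - {i}) f u j)))"
      by (simp only: ennreal_suminf_cmult[symmetric] mult.left_commute[of "w _" "of_bool _"])
    also have "\<dots> = w i * (\<Sum>u. \<Sum>j. of_bool (edge f i u) * (w j * of_bool (con (A - {i}) f u j)))"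
      by (subst suminf_ennreal_swap) simp
    finally show ?thesis using True by (simp add: csize_def)
  qed (simp add: con_def)
  then show ?thesis unfolding off_diag_def by (rule suminf_ennreal_mono)
qed

section \<open>Independence of the edges at a vertex from the rest of the graph\<close>

text \<open>The locale abstracts from the Poisson processes what the estimates use: independence of
  the counts and tail bounds at 1 and 2. The rate carries \<open>T / 2\<close> because two vertices
  share the counts of both orientations.\<close>

locale random_multigraph = prob_space M for M :: "'w measure" +
  fixes c :: "nat \<times> nat \<Rightarrow> 'w \<Rightarrow> nat" and x :: "nat \<Rightarrow> real" and T :: real
  assumes x_nonneg: "\<And>i. 0 \<le> x i" and T_nonneg: "0 \<le> T"
    and indep: "indep_vars (\<lambda>_. count_space UNIV) c UNIV"
    and prob_ge_1: "\<And>i j. prob {\<omega> \<in> space M. 1 \<le> c (i, j) \<omega>} \<le> T / 2 * x i * x j"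
    and prob_ge_2: "\<And>i j. prob {\<omega> \<in> space M. 2 \<le> c (i, j) \<omega>} \<le> (T / 2 * x i * x j)\<^sup>2"
begin

definition w :: "nat \<Rightarrow> ennreal" where "w i = ennreal (x i)"

definition Count :: "'w \<Rightarrow> nat \<times> nat \<Rightarrow> nat" where "Count \<omega> p = c p \<omega>"

lemma measurable_c [measurable]: "c p \<in> measurable M (count_space UNIV)"
  using indep unfolding indep_vars_def by blast

lemma measurable_Count [measurable]: "Count \<in> measurable M (counts UNIV)"
  unfolding Count_def[abs_def] by (rule measurable_PiM_single') (auto simp: space_PiM)

lemmas measurable_Count_compose [measurable] =
  measurable_compose[OF measurable_Count pred_edge[OF UNIV_I UNIV_I]]
  measurable_compose[OF measurable_Count pred_two_edges[OF subset_UNIV]]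
  measurable_compose[OF measurable_Count pred_con[OF subset_UNIV]]
  measurable_compose[OF measurable_Count measurable_csize[OF subset_UNIV]]
  measurable_compose[OF measurable_Count measurable_susc[OF subset_UNIV]]
  measurable_compose[OF measurable_Count measurable_off_diag]
  measurable_compose[OF measurable_Count measurable_through_sum]

lemma measurable_Count_local:
  assumes "g \<in> borel_measurable (counts I)" "\<And>f. g (restrict f I) = g f"
  shows "(\<lambda>\<omega>. g (Count \<omega>)) \<in> borel_measurable M"
proof -
  have "(\<lambda>\<omega>. restrict (Count \<omega>) I) \<in> measurable M (counts I)"
    using measurable_compose[OF measurable_Count measurable_restrict_subset[OF subset_UNIV]] by simp
  from measurable_compose[OF this assms(1)] show ?thesis by (simp add: assms(2))
qed

text \<open>The index sets \<open>star k\<close> and \<open>- star k\<close> are disjoint, so events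
  reading only the first are independent of functions reading only the second. The locality
  assumptions say that \<open>q\<close> and \<open>W\<close> ignore all other coordinates.\<close>

lemma nn_integral_star:
  assumes q: "Measurable.pred (counts (star k)) q"
    and q_local: "\<And>f. q (restrict f (star k)) = q f"
    and W: "W \<in> borel_measurable (counts (- star k))"
    and W_local: "\<And>f. W (restrict f (- star k)) = (W f :: ennreal)"
  shows "(\<integral>\<^sup>+\<omega>. of_bool (q (Count \<omega>)) * W (Count \<omega>) \<partial>M)
    = emeasure M {\<omega> \<in> space M. q (Count \<omega>)} * (\<integral>\<^sup>+\<omega>. W (Count \<omega>) \<partial>M)"
proof -
  have "indep_var (counts (star k)) (\<lambda>\<omega>. restrict (Count \<omega>) (star k))
      (counts (- star k)) (\<lambda>\<omega>. restrict (Count \<omega>) (- star k))"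
    unfolding Count_def[abs_def] by (rule indep_var_restrict[OF indep]) auto
  then have "indep_var borel ((\<lambda>f. of_bool (q f)) \<circ> (\<lambda>\<omega>. restrict (Count \<omega>) (star k)))
     borel (W \<circ> (\<lambda>\<omega>. restrict (Count \<omega>) (- star k)))"
    by (rule indep_var_compose) (use q W in measurable)
  then have "indep_var borel (\<lambda>\<omega>. of_bool (q (Count \<omega>)) :: ennreal) borel (\<lambda>\<omega>. W (Count \<omega>))"
    by (simp add: comp_def q_local W_local)
  \<comment> \<open>The pair becomes a family over \<open>bool\<close>, the form in which
    expectations of products factorise.\<close>
  then have iv: "indep_vars (\<lambda>_. borel) (case_bool (\<lambda>\<omega>. of_bool (q (Count \<omega>)) :: ennreal) (\<lambda>\<omega>. W (Count \<omega>))) UNIV"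
    unfolding indep_var_def by (rule indep_vars_cong[THEN iffD1, rotated -1]) (auto split: bool.split)
  have [measurable]: "Measurable.pred M (\<lambda>\<omega>. q (Count \<omega>))"
  proof -
    have "(\<lambda>\<omega>. restrict (Count \<omega>) (star k)) \<in> measurable M (counts (star k))"
      using \<open>indep_var (counts (star k)) _ _ _\<close> by (rule indep_var_rv1)
    from measurable_compose[OF this q] show ?thesis by (simp add: q_local)
  qed
  have "(\<integral>\<^sup>+\<omega>. of_bool (q (Count \<omega>)) * W (Count \<omega>) \<partial>M)
      = (\<integral>\<^sup>+\<omega>. of_bool (q (Count \<omega>)) \<partial>M) * (\<integral>\<^sup>+\<omega>. W (Count \<omega>) \<partial>M)"
    using indep_vars_nn_integral[OF _ iv] by (simp add: UNIV_bool mult.commute)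
  also have "(\<integral>\<^sup>+\<omega>. of_bool (q (Count \<omega>)) \<partial>M) = (\<integral>\<^sup>+\<omega>. indicator {\<omega> \<in> space M. q (Count \<omega>)} \<omega> \<partial>M)"
    by (intro nn_integral_cong) (auto simp: indicator_def)
  finally show ?thesis by simp
qed

lemma prob_both:
  assumes "p \<noteq> p'"
  shows "prob {\<omega> \<in> space M. 1 \<le> c p \<omega> \<and> 1 \<le> c p' \<omega>}
    = prob {\<omega> \<in> space M. 1 \<le> c p \<omega>} * prob {\<omega> \<in> space M. 1 \<le> c p' \<omega>}"
proof -
  have "prob (\<Inter>q\<in>{p, p'}. c q -` {1..} \<inter> space M) = (\<Prod>q\<in>{p, p'}. prob (c q -` {1..} \<inter> space M))"
    by (rule indep_varsD[OF indep]) auto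
  moreover have "(\<Inter>q\<in>{p, p'}. c q -` {1..} \<inter> space M) = {\<omega> \<in> space M. 1 \<le> c p \<omega> \<and> 1 \<le> c p' \<omega>}"
    "c q -` {1..} \<inter> space M = {\<omega> \<in> space M. 1 \<le> c q \<omega>}" for q
    by auto
  ultimately show ?thesis using assms by simp
qed

lemma emeasure_edge: "emeasure M {\<omega> \<in> space M. edge (Count \<omega>) k u} \<le> ennreal T * w k * w u"
proof -
  have "prob {\<omega> \<in> space M. edge (Count \<omega>) k u}
      \<le> prob ({\<omega> \<in> space M. 1 \<le> c (k, u) \<omega>} \<union> {\<omega> \<in> space M. 1 \<le> c (u, k) \<omega>})"
    by (intro finite_measure_mono) (auto simp: edge_def Count_def)
  also have "\<dots> \<le> prob {\<omega> \<in> space M. 1 \<le> c (k, u) \<omega>} + prob {\<omega> \<in> space M. 1 \<le> c (u, k) \<omega>}"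
    by (rule measure_Un_le) auto
  also have "\<dots> \<le> T * x k * x u"
    using prob_ge_1[of k u] prob_ge_1[of u k] by (simp add: mult_ac)
  finally show ?thesis
    using x_nonneg T_nonneg by (simp add: emeasure_eq_measure w_def ennreal_mult[symmetric] ennreal_leI)
qed

text \<open>With \<open>s i = T / 2 * x k * x i\<close>: for \<open>u \<noteq> v\<close> there are
  four choices of orientations, each of probability at most \<open>s u * s v\<close>. For
  \<open>u = v\<close> the edges share one of the two orientations or use one of each, which makes
  three cases. As \<open>u\<close> and \<open>v\<close> differ from \<open>k\<close>, the pairs
  involved are distinct, hence independent.\<close>

lemma emeasure_two_edges:
  assumes "u \<noteq> k" "v \<noteq> k"
  shows "emeasure M {\<omega> \<in> space M. two_edges (Count \<omega>) k u v} \<le> (ennreal T * w k)\<^sup>2 * (w u * w v)"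
proof -
  define s where "s i = T / 2 * x k * x i" for i
  have s: "prob {\<omega> \<in> space M. 1 \<le> c (k, i) \<omega>} \<le> s i" "prob {\<omega> \<in> space M. 1 \<le> c (i, k) \<omega>} \<le> s i"
    "prob {\<omega> \<in> space M. 2 \<le> c (k, i) \<omega>} \<le> (s i)\<^sup>2" "prob {\<omega> \<in> space M. 2 \<le> c (i, k) \<omega>} \<le> (s i)\<^sup>2" "0 \<le> s i" for i
    using prob_ge_1[of k i] prob_ge_1[of i k] prob_ge_2[of k i] prob_ge_2[of i k] x_nonneg T_nonneg
    by (simp_all add: s_def mult_ac)
  have both: "prob {\<omega> \<in> space M. 1 \<le> c p \<omega> \<and> 1 \<le> c p' \<omega>} \<le> s i * s j"
    if "p \<noteq> p'" "p = (k, i) \<or> p = (i, k)" "p' = (k, j) \<or> p' = (j, k)" for p p' i j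
  proof -
    have "prob {\<omega> \<in> space M. 1 \<le> c p \<omega>} \<le> s i" "prob {\<omega> \<in> space M. 1 \<le> c p' \<omega>} \<le> s j"
      using that(2,3) s(1,2) by blast+
    then show ?thesis unfolding prob_both[OF that(1)] by (intro mult_mono s) auto
  qed
  have "prob {\<omega> \<in> space M. two_edges (Count \<omega>) k u v} \<le> 4 * (s u * s v)"
  proof (cases "u = v")
    case True
    have "prob {\<omega> \<in> space M. two_edges (Count \<omega>) k u v}
        \<le> prob ({\<omega> \<in> space M. 2 \<le> c (k, u) \<omega>} \<union> ({\<omega> \<in> space M. 2 \<le> c (u, k) \<omega>}
            \<union> {\<omega> \<in> space M. 1 \<le> c (k, u) \<omega> \<and> 1 \<le> c (u, k) \<omega>}))"
      using True by (intro finite_measure_mono) (auto simp: two_edges_def Count_def)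
    also have "\<dots> \<le> prob {\<omega> \<in> space M. 2 \<le> c (k, u) \<omega>} + (prob {\<omega> \<in> space M. 2 \<le> c (u, k) \<omega>}
            + prob {\<omega> \<in> space M. 1 \<le> c (k, u) \<omega> \<and> 1 \<le> c (u, k) \<omega>})"
      by (intro order_trans[OF measure_Un_le] add_left_mono) auto
    also have "\<dots> \<le> (s u)\<^sup>2 + ((s u)\<^sup>2 + s u * s u)"
      using assms by (intro add_mono s both) auto
    also have "\<dots> \<le> 4 * (s u * s v)" using True by (simp add: power2_eq_square)
    finally show ?thesis .
  next
    case False
    let ?E = "\<lambda>p p'. {\<omega> \<in> space M. 1 \<le> c p \<omega> \<and> 1 \<le> c p' \<omega>}"
    have "prob {\<omega> \<in> space M. two_edges (Count \<omega>) k u v}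
        \<le> prob (?E (k, u) (k, v) \<union> (?E (k, u) (v, k) \<union> (?E (u, k) (k, v) \<union> ?E (u, k) (v, k))))"
      using False by (intro finite_measure_mono) (auto simp: two_edges_def edge_def Count_def)
    also have "\<dots> \<le> prob (?E (k, u) (k, v)) + (prob (?E (k, u) (v, k)) + (prob (?E (u, k) (k, v)) + prob (?E (u, k) (v, k))))"
      by (intro order_trans[OF measure_Un_le] add_left_mono) auto
    also have "\<dots> \<le> s u * s v + (s u * s v + (s u * s v + s u * s v))"
      using assms False by (intro add_mono both) auto
    finally show ?thesis by simp
  qed
  also have "4 * (s u * s v) = (T * x k)\<^sup>2 * (x u * x v)"
    by (simp add: s_def power2_eq_square)
  finally show ?thesis
    using x_nonneg T_nonneg
    by (simp add: emeasure_eq_measure w_def ennreal_mult[symmetric] ennreal_power ennreal_leI)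
qed

text \<open>Every edge indicator is independent of its factor \<open>W u\<close> and can be replaced
  by the bound on its probability. When \<open>W u\<close> is the size of the component of
  \<open>u\<close>, the remaining sum is again a susceptibility.\<close>

lemma nn_integral_edges_le:
  assumes W: "\<And>u. W u \<in> borel_measurable (counts (- star k))"
    and W_local: "\<And>u f. W u (restrict f (- star k)) = (W u f :: ennreal)"
  shows "(\<integral>\<^sup>+\<omega>. (\<Sum>u. of_bool (edge (Count \<omega>) k u) * W u (Count \<omega>)) \<partial>M)
    \<le> ennreal T * w k * (\<integral>\<^sup>+\<omega>. (\<Sum>u. w u * W u (Count \<omega>)) \<partial>M)"
proof -
  note [measurable] = measurable_Count_local[OF W W_local]
  have "(\<integral>\<^sup>+\<omega>. (\<Sum>u. of_bool (edge (Count \<omega>) k u) * W u (Count \<omega>)) \<partial>M)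
      = (\<Sum>u. \<integral>\<^sup>+\<omega>. of_bool (edge (Count \<omega>) k u) * W u (Count \<omega>) \<partial>M)"
    by (rule nn_integral_suminf) measurable
  also have "\<dots> = (\<Sum>u. emeasure M {\<omega> \<in> space M. edge (Count \<omega>) k u} * (\<integral>\<^sup>+\<omega>. W u (Count \<omega>) \<partial>M))"
  proof (intro arg_cong[where f = suminf] ext nn_integral_star)
    fix u
    show "Measurable.pred (counts (star k)) (\<lambda>f. edge f k u)"
      by (intro pred_edge) (auto simp: star_def)
    show "edge (restrict f (star k)) k u = edge f k u" for f
      by (simp add: edge_def star_def)
  qed (rule W W_local)+
  also have "\<dots> \<le> (\<Sum>u. ennreal T * w k * w u * (\<integral>\<^sup>+\<omega>. W u (Count \<omega>) \<partial>M))"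
    by (intro suminf_ennreal_mono mult_right_mono emeasure_edge) auto
  also have "\<dots> = ennreal T * w k * (\<Sum>u. \<integral>\<^sup>+\<omega>. w u * W u (Count \<omega>) \<partial>M)"
    by (simp add: nn_integral_cmult mult.assoc)
  also have "(\<Sum>u. \<integral>\<^sup>+\<omega>. w u * W u (Count \<omega>) \<partial>M) = (\<integral>\<^sup>+\<omega>. (\<Sum>u. w u * W u (Count \<omega>)) \<partial>M)"
    by (rule nn_integral_suminf[symmetric]) measurable
  finally show ?thesis .
qed

text \<open>The same replacement for pairs of edges. \<open>W_0\<close> removes the terms with
  \<open>u = k\<close> or \<open>v = k\<close>, to which \<open>emeasure_two_edges\<close> does not
  apply.\<close>

lemma nn_integral_two_edges_le:
  assumes W: "\<And>u v. W u v \<in> borel_measurable (counts (- star k))"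
    and W_local: "\<And>u v f. W u v (restrict f (- star k)) = (W u v f :: ennreal)"
    and W_0: "\<And>u v f. u = k \<or> v = k \<Longrightarrow> W u v f = 0"
  shows "(\<integral>\<^sup>+\<omega>. (\<Sum>u. \<Sum>v. of_bool (two_edges (Count \<omega>) k u v) * W u v (Count \<omega>)) \<partial>M)
    \<le> (ennreal T * w k)\<^sup>2 * (\<integral>\<^sup>+\<omega>. (\<Sum>u. \<Sum>v. w u * w v * W u v (Count \<omega>)) \<partial>M)"
proof -
  note [measurable] = measurable_Count_local[OF W W_local]
  have "(\<integral>\<^sup>+\<omega>. (\<Sum>u. \<Sum>v. of_bool (two_edges (Count \<omega>) k u v) * W u v (Count \<omega>)) \<partial>M)
      = (\<Sum>u. \<integral>\<^sup>+\<omega>. (\<Sum>v. of_bool (two_edges (Count \<omega>) k u v) * W u v (Count \<omega>)) \<partial>M)"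
    by (rule nn_integral_suminf) measurable
  also have "\<dots> = (\<Sum>u. \<Sum>v. \<integral>\<^sup>+\<omega>. of_bool (two_edges (Count \<omega>) k u v) * W u v (Count \<omega>) \<partial>M)"
    by (intro arg_cong[where f = suminf] ext nn_integral_suminf) measurable
  also have "\<dots> = (\<Sum>u. \<Sum>v. emeasure M {\<omega> \<in> space M. two_edges (Count \<omega>) k u v} * (\<integral>\<^sup>+\<omega>. W u v (Count \<omega>) \<partial>M))"
  proof (intro arg_cong[where f = suminf] ext nn_integral_star)
    fix u v
    show "Measurable.pred (counts (star k)) (\<lambda>f. two_edges f k u v)"
      by (intro pred_two_edges) simp
    show "two_edges (restrict f (star k)) k u v = two_edges f k u v" for f
      by (simp add: two_edges_def edge_def star_def)
  qed (rule W W_local)+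
  also have "\<dots> \<le> (\<Sum>u. \<Sum>v. (ennreal T * w k)\<^sup>2 * (w u * w v) * (\<integral>\<^sup>+\<omega>. W u v (Count \<omega>) \<partial>M))"
  proof (intro suminf_ennreal_mono)
    fix u v
    show "emeasure M {\<omega> \<in> space M. two_edges (Count \<omega>) k u v} * (\<integral>\<^sup>+\<omega>. W u v (Count \<omega>) \<partial>M)
      \<le> (ennreal T * w k)\<^sup>2 * (w u * w v) * (\<integral>\<^sup>+\<omega>. W u v (Count \<omega>) \<partial>M)"
      using W_0 emeasure_two_edges by (cases "u = k \<or> v = k") (auto intro: mult_right_mono)
  qed
  also have "\<dots> = (ennreal T * w k)\<^sup>2 * (\<Sum>u. \<Sum>v. \<integral>\<^sup>+\<omega>. w u * w v * W u v (Count \<omega>) \<partial>M)"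
    by (simp add: nn_integral_cmult mult.assoc)
  also have "(\<Sum>u. \<Sum>v. \<integral>\<^sup>+\<omega>. w u * w v * W u v (Count \<omega>) \<partial>M)
      = (\<Sum>u. \<integral>\<^sup>+\<omega>. (\<Sum>v. w u * w v * W u v (Count \<omega>)) \<partial>M)"
    by (intro arg_cong[where f = suminf] ext nn_integral_suminf[symmetric]) measurable
  also have "\<dots> = (\<integral>\<^sup>+\<omega>. (\<Sum>u. \<Sum>v. w u * w v * W u v (Count \<omega>)) \<partial>M)"
    by (rule nn_integral_suminf[symmetric]) measurable
  finally show ?thesis .
qed

end

text \<open>A uniform bound, which makes the expected susceptibility of a finite graph finite so
  that it may be subtracted from both sides of an inequality.\<close>

lemma susc_finite:
  assumes "finite A" "\<And>i. w i < \<infinity>"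
  shows "\<exists>b<\<infinity>. \<forall>f. susc w A f \<le> (b :: ennreal)"
proof (intro exI conjI allI)
  let ?a = "\<Sum>i. w i * of_bool (i \<in> A)"
  have "?a = (\<Sum>i\<in>A. w i)"
    by (subst suminf_finite[OF assms(1)]) auto
  also have "\<dots> < \<infinity>" using assms by (simp add: less_top[symmetric])
  finally show "?a * ?a < \<infinity>" by (simp add: ennreal_mult_less_top)
  show "susc w A f \<le> ?a * ?a" for f
  proof -
    have "susc w A f = (\<Sum>i. \<Sum>j. w i * (w j * of_bool (con A f i j)))"
      by (simp add: susc_def csize_def)
    also have "\<dots> \<le> (\<Sum>i. \<Sum>j. w i * of_bool (i \<in> A) * (w j * of_bool (j \<in> A)))"
      by (intro suminf_ennreal_mono) (auto simp: of_bool_def dest: con_in)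
    finally show ?thesis by simp
  qed
qed

lemma off_diag_mono: "A \<subseteq> B \<Longrightarrow> off_diag w A f \<le> off_diag w B f"
  unfolding off_diag_def
  by (intro suminf_ennreal_mono mult_left_mono) (auto simp: of_bool_def intro: con_mono)

text \<open>By \<open>con_finite\<close> each connection indicator is the increasing limit of those
  on finite truncations, and suprema of monotone sequences commute with both series.\<close>

lemma off_diag_SUP: "off_diag w A f = (SUP n. off_diag w (A \<inter> {..<n}) f)"
proof -
  have con: "of_bool (con A f i j \<and> i \<noteq> j) = (SUP n. of_bool (con (A \<inter> {..<n}) f i j \<and> i \<noteq> j) :: ennreal)" for i j
  proof (cases "con A f i j \<and> i \<noteq> j")
    case True
    then obtain n where "con (A \<inter> {..<n}) f i j" using con_finite by blast
    then have "1 \<le> (SUP n. of_bool (con (A \<inter> {..<n}) f i j \<and> i \<noteq> j) :: ennreal)"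
      using True by (intro SUP_upper2[of n]) auto
    moreover have "(SUP n. of_bool (con (A \<inter> {..<n}) f i j \<and> i \<noteq> j) :: ennreal) \<le> 1"
      by (intro SUP_least) auto
    ultimately show ?thesis using True by simp
  next
    case False
    then have "\<not> (con (A \<inter> {..<n}) f i j \<and> i \<noteq> j)" for n by (auto dest: con_mono)
    with False show ?thesis by (simp del: de_Morgan_conj)
  qed
  have inc: "of_bool (con (A \<inter> {..<n}) f i j \<and> i \<noteq> j) \<le> (of_bool (con (A \<inter> {..<m}) f i j \<and> i \<noteq> j) :: ennreal)"
    if "n \<le> m" for n m i j
    using that by (auto simp: of_bool_def intro: con_mono)
  have "off_diag w A f = (\<Sum>i. \<Sum>j. SUP n. w i * (w j * of_bool (con (A \<inter> {..<n}) f i j \<and> i \<noteq> j)))"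
    unfolding off_diag_def con by (simp add: SUP_mult_left_ennreal)
  also have "\<dots> = (\<Sum>i. SUP n. \<Sum>j. w i * (w j * of_bool (con (A \<inter> {..<n}) f i j \<and> i \<noteq> j)))"
    by (intro arg_cong[where f = suminf] ext ennreal_suminf_SUP_eq monoI mult_left_mono inc) auto
  also have "\<dots> = (SUP n. \<Sum>i. \<Sum>j. w i * (w j * of_bool (con (A \<inter> {..<n}) f i j \<and> i \<noteq> j)))"
    by (intro ennreal_suminf_SUP_eq monoI suminf_ennreal_mono mult_left_mono inc) auto
  finally show ?thesis by (simp add: off_diag_def)
qed

text \<open>Markov's inequality, with the bound on the expectation already factored.\<close>

lemma (in prob_space) prob_ge_le:
  assumes u: "u \<in> borel_measurable M" and "0 < a" "0 \<le> b" "(\<integral>\<^sup>+\<omega>. u \<omega> \<partial>M) \<le> ennreal (a * b)"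
  shows "prob {\<omega> \<in> space M. ennreal a \<le> u \<omega>} \<le> b"
proof -
  let ?B = "{\<omega> \<in> space M. ennreal a \<le> u \<omega>}"
  have B: "?B \<in> sets M" using u by measurable
  have "ennreal a * emeasure M ?B = (\<integral>\<^sup>+\<omega>. ennreal a * indicator ?B \<omega> \<partial>M)"
    using B by (simp add: nn_integral_cmult)
  also have "\<dots> \<le> (\<integral>\<^sup>+\<omega>. u \<omega> \<partial>M)"
    by (intro nn_integral_mono) (auto simp: indicator_def)
  also have "\<dots> \<le> ennreal (a * b)" by fact
  finally have "ennreal (a * prob ?B) \<le> ennreal (a * b)"
    using assms by (simp add: emeasure_eq_measure ennreal_mult)
  then show ?thesis using assms by (simp add: ennreal_le_iff)
qed

lemma off_star: "(A - {k}) \<times> (A - {k}) \<subseteq> - star k"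
  by (auto simp: star_def)

lemma restrict_off_star:
  "con (A - {k}) (restrict f (- star k)) = con (A - {k}) f"
  "csize w (A - {k}) (restrict f (- star k)) = csize w (A - {k}) f"
  "susc w (A - {k}) (restrict f (- star k)) = susc w (A - {k}) f"
  using off_star[of A k]
  by (auto intro!: ext con_cong csize_cong susc_cong simp: restrict_apply)

section \<open>Expectation bounds\<close>

context random_multigraph
begin

lemma w_finite [simp]: "w i < \<infinity>" "w i < top"
  by (simp_all add: w_def)

text \<open>The expectation of the peeling bound: by independence \<open>i\<close> contributes at
  most \<open>T * (w i)^2\<close> times the expected susceptibility without \<open>i\<close>, which
  is at most the one of \<open>A\<close>.\<close>

lemma nn_integral_off_diag_le_susc:
  "(\<integral>\<^sup>+\<omega>. off_diag w A (Count \<omega>) \<partial>M)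
     \<le> ennreal T * sq_sum w A * (\<integral>\<^sup>+\<omega>. susc w A (Count \<omega>) \<partial>M)"
proof -
  let ?C = "\<lambda>i u \<omega>. csize w (A - {i}) (Count \<omega>) u"
  have "(\<integral>\<^sup>+\<omega>. off_diag w A (Count \<omega>) \<partial>M)
      \<le> (\<integral>\<^sup>+\<omega>. (\<Sum>i. of_bool (i \<in> A) * w i * (\<Sum>u. of_bool (edge (Count \<omega>) i u) * ?C i u \<omega>)) \<partial>M)"
    by (intro nn_integral_mono off_diag_le_edges)
  also have "\<dots> = (\<Sum>i. \<integral>\<^sup>+\<omega>. of_bool (i \<in> A) * w i * (\<Sum>u. of_bool (edge (Count \<omega>) i u) * ?C i u \<omega>) \<partial>M)"
    by (rule nn_integral_suminf) measurable
  also have "\<dots> = (\<Sum>i. of_bool (i \<in> A) * w i * (\<integral>\<^sup>+\<omega>. (\<Sum>u. of_bool (edge (Count \<omega>) i u) * ?C i u \<omega>) \<partial>M))"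
    by (intro arg_cong[where f = suminf] ext nn_integral_cmult) measurable
  also have "\<dots> \<le> (\<Sum>i. of_bool (i \<in> A) * w i * (ennreal T * w i * (\<integral>\<^sup>+\<omega>. susc w A (Count \<omega>) \<partial>M)))"
  proof (intro suminf_ennreal_mono mult_left_mono)
    fix i
    have "(\<integral>\<^sup>+\<omega>. (\<Sum>u. of_bool (edge (Count \<omega>) i u) * ?C i u \<omega>) \<partial>M)
        \<le> ennreal T * w i * (\<integral>\<^sup>+\<omega>. (\<Sum>u. w u * ?C i u \<omega>) \<partial>M)"
      using nn_integral_edges_le[of "\<lambda>u f. csize w (A - {i}) f u" i]
      by (simp add: restrict_off_star measurable_csize[OF off_star])
    also have "\<dots> \<le> ennreal T * w i * (\<integral>\<^sup>+\<omega>. susc w A (Count \<omega>) \<partial>M)"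
      unfolding susc_def[symmetric] by (intro mult_left_mono nn_integral_mono susc_mono) auto
    finally show "(\<integral>\<^sup>+\<omega>. (\<Sum>u. of_bool (edge (Count \<omega>) i u) * ?C i u \<omega>) \<partial>M) \<le> \<dots>" .
  qed simp
  also have "\<dots> = (\<Sum>i. (ennreal T * (\<integral>\<^sup>+\<omega>. susc w A (Count \<omega>) \<partial>M)) * (of_bool (i \<in> A) * (w i)\<^sup>2))"
    by (intro arg_cong[where f = suminf] ext) (simp add: power2_eq_square mult_ac)
  also have "\<dots> = ennreal T * sq_sum w A * (\<integral>\<^sup>+\<omega>. susc w A (Count \<omega>) \<partial>M)"
    unfolding ennreal_suminf_cmult sq_sum_def by (simp only: mult_ac)
  finally show ?thesis .
qed

text \<open>For the expectation e and \<open>s = sq_sum w A\<close>, peeling gives e \<le> s + e /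
  2. Since \<open>A\<close> is finite, so is e, and e / 2 can be absorbed on the left.\<close>

lemma nn_integral_susc_le:
  assumes "finite A" "ennreal T * sq_sum w A \<le> ennreal (1 / 2)"
  shows "(\<integral>\<^sup>+\<omega>. susc w A (Count \<omega>) \<partial>M) \<le> 2 * sq_sum w A"
proof -
  let ?e = "\<integral>\<^sup>+\<omega>. susc w A (Count \<omega>) \<partial>M"
  obtain b where b: "b < \<infinity>" "\<And>f. susc w A f \<le> b"
    using susc_finite[OF assms(1), of w] by auto
  have "?e \<le> (\<integral>\<^sup>+\<omega>. b \<partial>M)" by (intro nn_integral_mono b)
  also have "\<dots> < \<infinity>" using b by (simp add: emeasure_space_1)
  finally have fin: "?e < \<infinity>" .
  have "?e = sq_sum w A + (\<integral>\<^sup>+\<omega>. off_diag w A (Count \<omega>) \<partial>M)"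
    by (subst susc_eq, subst nn_integral_add) (auto simp: emeasure_space_1)
  also have "\<dots> \<le> sq_sum w A + ennreal T * sq_sum w A * ?e"
    by (intro add_left_mono nn_integral_off_diag_le_susc)
  also have "\<dots> \<le> sq_sum w A + ennreal (1 / 2) * ?e"
    using assms(2) by (intro add_left_mono mult_right_mono) auto
  finally have le: "?e \<le> sq_sum w A + ennreal (1 / 2) * ?e" .
  show ?thesis
  proof (cases "sq_sum w A = \<infinity>")
    case False
    then obtain s e where s: "sq_sum w A = ennreal s" "0 \<le> s" and e: "?e = ennreal e" "0 \<le> e"
      using fin by (metis ennreal_cases infinity_ennreal_def less_irrefl)
    have "ennreal (1 / 2 * e) = ennreal (1 / 2) * ennreal e"
      by (rule ennreal_mult) (use e in auto)
    moreover have "ennreal (s + 1 / 2 * e) = ennreal s + ennreal (1 / 2 * e)"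
      by (rule ennreal_plus) (use s e in auto)
    ultimately have "ennreal e \<le> ennreal (s + 1 / 2 * e)"
      using le unfolding e(1) s(1) by simp
    then have "e \<le> s + 1 / 2 * e"
      by (rule ennreal_le_iff[THEN iffD1, rotated]) (use s e in auto)
    then have "e \<le> 2 * s" by simp
    then have "ennreal e \<le> ennreal (2 * s)" by (rule ennreal_leI)
    then show ?thesis using s e by (simp add: ennreal_mult)
  qed (simp add: ennreal_mult_top)
qed

text \<open>The two preceding bounds combine on each truncation \<open>A \<inter> {..<n}\<close>,
  where \<open>sq_sum\<close> is only smaller. The resulting bound does not depend on
  \<open>n\<close> and passes to the limit by monotone convergence.\<close>

lemma nn_integral_off_diag_le:
  assumes "ennreal T * sq_sum w A \<le> ennreal (1 / 2)"
  shows "(\<integral>\<^sup>+\<omega>. off_diag w A (Count \<omega>) \<partial>M) \<le> ennreal T * sq_sum w A * (2 * sq_sum w A)"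
proof -
  have "(\<integral>\<^sup>+\<omega>. off_diag w A (Count \<omega>) \<partial>M) = (\<integral>\<^sup>+\<omega>. (SUP n. off_diag w (A \<inter> {..<n}) (Count \<omega>)) \<partial>M)"
    by (simp only: off_diag_SUP[of w A])
  also have "\<dots> = (SUP n. \<integral>\<^sup>+\<omega>. off_diag w (A \<inter> {..<n}) (Count \<omega>) \<partial>M)"
    by (intro nn_integral_monotone_convergence_SUP incseq_SucI le_funI off_diag_mono) auto
  also have "\<dots> \<le> ennreal T * sq_sum w A * (2 * sq_sum w A)"
  proof (rule SUP_least)
    fix n
    have sq: "sq_sum w (A \<inter> {..<n}) \<le> sq_sum w A" by (rule sq_sum_mono) auto
    have "ennreal T * sq_sum w (A \<inter> {..<n}) \<le> ennreal (1 / 2)"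
      using mult_left_mono[OF sq, of "ennreal T"] assms by auto
    then have "(\<integral>\<^sup>+\<omega>. susc w (A \<inter> {..<n}) (Count \<omega>) \<partial>M) \<le> 2 * sq_sum w (A \<inter> {..<n})"
      by (intro nn_integral_susc_le) auto
    then show "(\<integral>\<^sup>+\<omega>. off_diag w (A \<inter> {..<n}) (Count \<omega>) \<partial>M) \<le> ennreal T * sq_sum w A * (2 * sq_sum w A)"
      using sq mult_left_mono[OF sq, of 2]
      by (intro order_trans[OF nn_integral_off_diag_le_susc] mult_mono) (auto intro: order_trans)
  qed
  finally show ?thesis .
qed

lemma emeasure_loop_le:
  "emeasure M {\<omega> \<in> space M. \<exists>k\<in>A. 1 \<le> c (k, k) \<omega>} \<le> ennreal T * sq_sum w A"
proof -
  have "emeasure M {\<omega> \<in> space M. \<exists>k\<in>A. 1 \<le> c (k, k) \<omega>}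
      = emeasure M (\<Union>k. if k \<in> A then {\<omega> \<in> space M. 1 \<le> c (k, k) \<omega>} else {})"
    by (intro arg_cong[where f = "emeasure M"]) (auto split: if_splits)
  also have "\<dots> \<le> (\<Sum>k. emeasure M (if k \<in> A then {\<omega> \<in> space M. 1 \<le> c (k, k) \<omega>} else {}))"
    by (intro emeasure_subadditive_countably) (auto split: if_splits)
  also have "\<dots> \<le> (\<Sum>k. ennreal T * (of_bool (k \<in> A) * (w k)\<^sup>2))"
  proof (rule suminf_ennreal_mono)
    fix k
    have "prob {\<omega> \<in> space M. 1 \<le> c (k, k) \<omega>} \<le> T / 2 * x k * x k"
      by (rule prob_ge_1)
    also have "\<dots> \<le> T * (x k)\<^sup>2"
      using T_nonneg by (simp add: power2_eq_square mult_right_mono)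
    finally have "emeasure M {\<omega> \<in> space M. 1 \<le> c (k, k) \<omega>} \<le> ennreal T * (w k)\<^sup>2"
      using T_nonneg x_nonneg by (simp add: emeasure_eq_measure w_def ennreal_power ennreal_mult[symmetric] ennreal_leI)
    then show "emeasure M (if k \<in> A then {\<omega> \<in> space M. 1 \<le> c (k, k) \<omega>} else {})
        \<le> ennreal T * (of_bool (k \<in> A) * (w k)\<^sup>2)"
      by simp
  qed
  finally show ?thesis by (simp add: sq_sum_def)
qed

text \<open>The event \<open>susc w V < \<kappa>\<close> depends on the edges at \<open>k\<close>,
  so it is weakened to the same event for \<open>V - {k}\<close>, which does not. Independence and
  the bound for two edges then leave the sum of \<open>w u * w v\<close> over pairs connected
  outside \<open>k\<close>; this is \<open>susc w (V - {k})\<close>, below \<open>\<kappa>\<close>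
  on the weakened event.\<close>

lemma nn_integral_two_edges_con_le:
  "(\<integral>\<^sup>+\<omega>. of_bool (susc w V (Count \<omega>) < \<kappa> \<and>
       (\<exists>k\<in>A. \<exists>u v. two_edges (Count \<omega>) k u v \<and> con (V - {k}) (Count \<omega>) u v)) \<partial>M)
     \<le> (ennreal T)\<^sup>2 * \<kappa> * sq_sum w A"
proof -
  define W where "W k u v f = (of_bool (con (V - {k}) f u v) * of_bool (susc w (V - {k}) f < \<kappa>) :: ennreal)" for k u v f
  note [measurable] = measurable_susc[OF off_star] pred_con[OF off_star]
  have W: "W k u v \<in> borel_measurable (counts (- star k))" for k u v
  proof -
    have "(\<lambda>f. W k u v f) \<in> borel_measurable (counts (- star k))" unfolding W_def by measurable
    then show ?thesis .
  qed
  have WM [measurable]: "(\<lambda>\<omega>. W k u v (Count \<omega>)) \<in> borel_measurable M" for k u v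
    unfolding W_def by measurable
  have "(\<integral>\<^sup>+\<omega>. of_bool (susc w V (Count \<omega>) < \<kappa> \<and>
       (\<exists>k\<in>A. \<exists>u v. two_edges (Count \<omega>) k u v \<and> con (V - {k}) (Count \<omega>) u v)) \<partial>M)
     \<le> (\<integral>\<^sup>+\<omega>. (\<Sum>k. of_bool (k \<in> A) * (\<Sum>u. \<Sum>v. of_bool (two_edges (Count \<omega>) k u v) * W k u v (Count \<omega>))) \<partial>M)"
  proof (rule nn_integral_mono)
    fix \<omega>
    let ?f = "Count \<omega>"
    show "of_bool (susc w V ?f < \<kappa> \<and> (\<exists>k\<in>A. \<exists>u v. two_edges ?f k u v \<and> con (V - {k}) ?f u v))
      \<le> (\<Sum>k. of_bool (k \<in> A) * (\<Sum>u. \<Sum>v. of_bool (two_edges ?f k u v) * W k u v ?f))"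
    proof (cases "susc w V ?f < \<kappa> \<and> (\<exists>k\<in>A. \<exists>u v. two_edges ?f k u v \<and> con (V - {k}) ?f u v)")
      case True
      then obtain k u v where k: "k \<in> A" "two_edges ?f k u v" "con (V - {k}) ?f u v" "susc w V ?f < \<kappa>"
        by auto
      have "susc w (V - {k}) ?f < \<kappa>"
        using susc_mono[of "V - {k}" V ?f ?f w] k(4) by auto
      then have "1 = of_bool (two_edges ?f k u v) * W k u v ?f" using k by (simp add: W_def)
      also have "\<dots> \<le> (\<Sum>v. of_bool (two_edges ?f k u v) * W k u v ?f)" by (rule suminf_ennreal_ge_term)
      also have "\<dots> \<le> (\<Sum>u. \<Sum>v. of_bool (two_edges ?f k u v) * W k u v ?f)" by (rule suminf_ennreal_ge_term)
      also have "\<dots> = of_bool (k \<in> A) * \<dots>" using k by simp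
      also have "\<dots> \<le> (\<Sum>k. of_bool (k \<in> A) * (\<Sum>u. \<Sum>v. of_bool (two_edges ?f k u v) * W k u v ?f))"
        by (rule suminf_ennreal_ge_term)
      finally show ?thesis using True by simp
    next
      case False
      then show ?thesis unfolding of_bool_eq_0_iff[THEN iffD2, OF False] by simp
    qed
  qed
  also have "\<dots> = (\<Sum>k. \<integral>\<^sup>+\<omega>. of_bool (k \<in> A) * (\<Sum>u. \<Sum>v. of_bool (two_edges (Count \<omega>) k u v) * W k u v (Count \<omega>)) \<partial>M)"
    by (rule nn_integral_suminf) measurable
  also have "\<dots> = (\<Sum>k. of_bool (k \<in> A) * (\<integral>\<^sup>+\<omega>. (\<Sum>u. \<Sum>v. of_bool (two_edges (Count \<omega>) k u v) * W k u v (Count \<omega>)) \<partial>M))"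
    by (intro arg_cong[where f = suminf] ext nn_integral_cmult) measurable
  also have "\<dots> \<le> (\<Sum>k. of_bool (k \<in> A) * ((ennreal T * w k)\<^sup>2 * \<kappa>))"
  proof (intro suminf_ennreal_mono mult_left_mono)
    fix k
    have "(\<integral>\<^sup>+\<omega>. (\<Sum>u. \<Sum>v. of_bool (two_edges (Count \<omega>) k u v) * W k u v (Count \<omega>)) \<partial>M)
        \<le> (ennreal T * w k)\<^sup>2 * (\<integral>\<^sup>+\<omega>. (\<Sum>u. \<Sum>v. w u * w v * W k u v (Count \<omega>)) \<partial>M)"
      by (rule nn_integral_two_edges_le[OF W]) (auto simp: W_def restrict_off_star dest: con_in)
    also have "(\<integral>\<^sup>+\<omega>. (\<Sum>u. \<Sum>v. w u * w v * W k u v (Count \<omega>)) \<partial>M) \<le> (\<integral>\<^sup>+\<omega>. \<kappa> \<partial>M)"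
    proof (rule nn_integral_mono)
      fix \<omega>
      let ?S = "susc w (V - {k}) (Count \<omega>)"
      have "(\<Sum>u. \<Sum>v. w u * w v * W k u v (Count \<omega>))
          = (\<Sum>u. \<Sum>v. of_bool (?S < \<kappa>) * (w u * (w v * of_bool (con (V - {k}) (Count \<omega>) u v))))"
        by (simp only: W_def mult_ac)
      also have "\<dots> = of_bool (?S < \<kappa>) * ?S"
        by (simp only: ennreal_suminf_cmult susc_def csize_def)
      also have "\<dots> \<le> \<kappa>" by (simp add: of_bool_def less_imp_le)
      finally show "(\<Sum>u. \<Sum>v. w u * w v * W k u v (Count \<omega>)) \<le> \<kappa>" .
    qed
    finally show "(\<integral>\<^sup>+\<omega>. (\<Sum>u. \<Sum>v. of_bool (two_edges (Count \<omega>) k u v) * W k u v (Count \<omega>)) \<partial>M)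
        \<le> (ennreal T * w k)\<^sup>2 * \<kappa>"
      by (simp add: emeasure_space_1 mult_left_mono)
  qed simp
  also have "\<dots> = (\<Sum>k. ((ennreal T)\<^sup>2 * \<kappa>) * (of_bool (k \<in> A) * (w k)\<^sup>2))"
    by (intro arg_cong[where f = suminf] ext) (simp add: power2_eq_square mult_ac)
  finally show ?thesis by (simp only: ennreal_suminf_cmult sq_sum_def)
qed

text \<open>The truncation is again weakened to \<open>V - {k}\<close>. The three terms of
  \<open>through_sum_eq\<close> then have expectations at most \<open>(w k)^2\<close> times 1,
  \<open>2 * T * \<kappa>\<close> and \<open>(T * \<kappa>)^2\<close>, which add up to a
  square.\<close>

lemma nn_integral_through_sum_le:
  "(\<integral>\<^sup>+\<omega>. of_bool (susc w V (Count \<omega>) < \<kappa>) * (\<Sum>k. of_bool (k \<in> A) * through_sum w V (Count \<omega>) k) \<partial>M)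
     \<le> (1 + ennreal T * \<kappa>)\<^sup>2 * sq_sum w A"
proof -
  define X where "X k f = (of_bool (susc w (V - {k}) f < \<kappa>) :: ennreal)" for k f
  note [measurable] = measurable_susc[OF off_star] pred_con[OF off_star] measurable_csize[OF off_star]
  have X [measurable]: "(\<lambda>f. X k f) \<in> borel_measurable (counts (- star k))" for k
    unfolding X_def by measurable
  have XM [measurable]: "(\<lambda>\<omega>. X k (Count \<omega>)) \<in> borel_measurable M" for k
    unfolding X_def by measurable
  define W1 where "W1 k u f = X k f * csize w (V - {k}) f u" for k u f
  define W2 where "W2 k u v f = X k f * (csize w (V - {k}) f u * csize w (V - {k}) f v)" for k u v f
  have W1: "W1 k u \<in> borel_measurable (counts (- star k))" for k u
  proof -
    have "(\<lambda>f. W1 k u f) \<in> borel_measurable (counts (- star k))" unfolding W1_def by measurable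
    then show ?thesis .
  qed
  have W2: "W2 k u v \<in> borel_measurable (counts (- star k))" for k u v
  proof -
    have "(\<lambda>f. W2 k u v f) \<in> borel_measurable (counts (- star k))" unfolding W2_def by measurable
    then show ?thesis .
  qed
  have [measurable]: "(\<lambda>\<omega>. W1 k u (Count \<omega>)) \<in> borel_measurable M"
    "(\<lambda>\<omega>. W2 k u v (Count \<omega>)) \<in> borel_measurable M" for k u v
    unfolding W1_def W2_def by measurable
  let ?D = "\<lambda>k \<omega>. (w k)\<^sup>2 + 2 * w k * (\<Sum>u. of_bool (edge (Count \<omega>) k u) * W1 k u (Count \<omega>))
     + (\<Sum>u. \<Sum>v. of_bool (two_edges (Count \<omega>) k u v) * W2 k u v (Count \<omega>))"
  have "(\<integral>\<^sup>+\<omega>. of_bool (susc w V (Count \<omega>) < \<kappa>) * (\<Sum>k. of_bool (k \<in> A) * through_sum w V (Count \<omega>) k) \<partial>M)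
      \<le> (\<integral>\<^sup>+\<omega>. (\<Sum>k. of_bool (k \<in> A) * ?D k \<omega>) \<partial>M)"
  proof (rule nn_integral_mono)
    fix \<omega>
    let ?f = "Count \<omega>"
    show "of_bool (susc w V ?f < \<kappa>) * (\<Sum>k. of_bool (k \<in> A) * through_sum w V ?f k)
       \<le> (\<Sum>k. of_bool (k \<in> A) * ?D k \<omega>)"
    proof (cases "susc w V ?f < \<kappa>")
      case True
      then have "susc w (V - {k}) ?f < \<kappa>" for k
        using susc_mono[of "V - {k}" V ?f ?f w] by auto
      then have "through_sum w V ?f k = ?D k \<omega>" for k
        unfolding through_sum_eq W1_def W2_def X_def by simp
      then show ?thesis using True by simp
    qed simp
  qed
  also have "\<dots> = (\<Sum>k. \<integral>\<^sup>+\<omega>. of_bool (k \<in> A) * ?D k \<omega> \<partial>M)"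
    by (rule nn_integral_suminf) measurable
  also have "\<dots> = (\<Sum>k. of_bool (k \<in> A) * (\<integral>\<^sup>+\<omega>. ?D k \<omega> \<partial>M))"
    by (intro arg_cong[where f = suminf] ext nn_integral_cmult) measurable
  also have "\<dots> \<le> (\<Sum>k. of_bool (k \<in> A) * ((1 + ennreal T * \<kappa>)\<^sup>2 * (w k)\<^sup>2))"
  proof (intro suminf_ennreal_mono mult_left_mono)
    fix k
    let ?S = "\<lambda>\<omega>. susc w (V - {k}) (Count \<omega>)"
    have "(\<integral>\<^sup>+\<omega>. (\<Sum>u. of_bool (edge (Count \<omega>) k u) * W1 k u (Count \<omega>)) \<partial>M)
        \<le> ennreal T * w k * (\<integral>\<^sup>+\<omega>. (\<Sum>u. w u * W1 k u (Count \<omega>)) \<partial>M)"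
      by (rule nn_integral_edges_le[OF W1]) (simp add: W1_def X_def restrict_off_star)
    also have "(\<integral>\<^sup>+\<omega>. (\<Sum>u. w u * W1 k u (Count \<omega>)) \<partial>M) \<le> (\<integral>\<^sup>+\<omega>. \<kappa> \<partial>M)"
    proof (rule nn_integral_mono)
      fix \<omega>
      have "(\<Sum>u. w u * W1 k u (Count \<omega>)) = of_bool (?S \<omega> < \<kappa>) * ?S \<omega>"
        by (simp add: W1_def X_def susc_def mult.left_commute[of "w _" "of_bool _"])
      also have "\<dots> \<le> \<kappa>" by (simp add: of_bool_def less_imp_le)
      finally show "(\<Sum>u. w u * W1 k u (Count \<omega>)) \<le> \<kappa>" .
    qed
    finally have 1: "(\<integral>\<^sup>+\<omega>. (\<Sum>u. of_bool (edge (Count \<omega>) k u) * W1 k u (Count \<omega>)) \<partial>M) \<le> ennreal T * w k * \<kappa>"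
      by (simp add: emeasure_space_1 mult_left_mono)
    have "(\<integral>\<^sup>+\<omega>. (\<Sum>u. \<Sum>v. of_bool (two_edges (Count \<omega>) k u v) * W2 k u v (Count \<omega>)) \<partial>M)
        \<le> (ennreal T * w k)\<^sup>2 * (\<integral>\<^sup>+\<omega>. (\<Sum>u. \<Sum>v. w u * w v * W2 k u v (Count \<omega>)) \<partial>M)"
      by (rule nn_integral_two_edges_le[OF W2]) (auto simp: W2_def X_def restrict_off_star csize_outside)
    also have "(\<integral>\<^sup>+\<omega>. (\<Sum>u. \<Sum>v. w u * w v * W2 k u v (Count \<omega>)) \<partial>M) \<le> (\<integral>\<^sup>+\<omega>. \<kappa>\<^sup>2 \<partial>M)"
    proof (rule nn_integral_mono)
      fix \<omega>
      let ?C = "csize w (V - {k}) (Count \<omega>)"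
      have "(\<Sum>u. \<Sum>v. w u * w v * W2 k u v (Count \<omega>))
          = (\<Sum>u. \<Sum>v. of_bool (?S \<omega> < \<kappa>) * ((w u * ?C u) * (w v * ?C v)))"
        by (simp only: W2_def X_def mult_ac)
      \<comment> \<open>Unlike for cycles, \<open>u\<close> and \<open>v\<close> need not be
        connected to each other, so the double sum factorises into two susceptibilities.\<close>
      also have "\<dots> = of_bool (?S \<omega> < \<kappa>) * (?S \<omega> * ?S \<omega>)"
        by (simp only: ennreal_suminf_cmult ennreal_suminf_multc susc_def)
      also have "\<dots> \<le> \<kappa>\<^sup>2" by (auto simp: of_bool_def power2_eq_square intro!: mult_mono)
      finally show "(\<Sum>u. \<Sum>v. w u * w v * W2 k u v (Count \<omega>)) \<le> \<kappa>\<^sup>2" .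
    qed
    finally have 2: "(\<integral>\<^sup>+\<omega>. (\<Sum>u. \<Sum>v. of_bool (two_edges (Count \<omega>) k u v) * W2 k u v (Count \<omega>)) \<partial>M)
        \<le> (ennreal T * w k)\<^sup>2 * \<kappa>\<^sup>2"
      by (simp add: emeasure_space_1 mult_left_mono)
    have "(\<integral>\<^sup>+\<omega>. ?D k \<omega> \<partial>M) = (w k)\<^sup>2
        + 2 * w k * (\<integral>\<^sup>+\<omega>. (\<Sum>u. of_bool (edge (Count \<omega>) k u) * W1 k u (Count \<omega>)) \<partial>M)
        + (\<integral>\<^sup>+\<omega>. (\<Sum>u. \<Sum>v. of_bool (two_edges (Count \<omega>) k u v) * W2 k u v (Count \<omega>)) \<partial>M)"
      by (simp add: nn_integral_add nn_integral_cmult emeasure_space_1)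
    also have "\<dots> \<le> (w k)\<^sup>2 + 2 * w k * (ennreal T * w k * \<kappa>) + (ennreal T * w k)\<^sup>2 * \<kappa>\<^sup>2"
      by (intro add_mono mult_left_mono 1 2) auto
    also have "\<dots> = (1 + ennreal T * \<kappa>)\<^sup>2 * (w k)\<^sup>2"
      by (simp add: power2_eq_square algebra_simps mult_2 mult_2_right)
    finally show "(\<integral>\<^sup>+\<omega>. ?D k \<omega> \<partial>M) \<le> (1 + ennreal T * \<kappa>)\<^sup>2 * (w k)\<^sup>2" .
  qed simp
  also have "\<dots> = (\<Sum>k. (1 + ennreal T * \<kappa>)\<^sup>2 * (of_bool (k \<in> A) * (w k)\<^sup>2))"
    by (intro arg_cong[where f = suminf] ext) (simp add: mult_ac)
  finally show ?thesis by (simp only: ennreal_suminf_cmult sq_sum_def)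
qed

section \<open>The good event\<close>

text \<open>\<open>E\<close> is the complement of five bad events: large susceptibility, many
  connected pairs of small vertices, a loop at a small vertex, a longer cycle through one, and large
  losses through tiny vertices. The first has probability at most \<open>\<epsilon> / 100\<close> by
  assumption and each other at most \<open>\<epsilon>^2 / 100\<close>, so together they stay below
  \<open>\<epsilon>\<close>.\<close>

lemma good_event:
  assumes \<epsilon>: "0 < \<epsilon>" "\<epsilon> < 1" and K: "1 \<le> K" and \<epsilon>\<^sub>1: "0 < \<epsilon>\<^sub>1"
    and prob_K: "prob {\<omega> \<in> space M. ennreal K \<le> susc w V (Count \<omega>)} \<le> \<epsilon> / 100"
    and H: "sq_sum w H \<le> ennreal (\<epsilon>\<^sup>2 / (100 * (1 + T + K * T\<^sup>2)))"
    and L: "sq_sum w L \<le> ennreal (2 * \<epsilon>\<^sub>1\<^sup>2 * \<epsilon>\<^sup>2 / (100 * (1 + T * (K + 2))\<^sup>2))"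
  obtains E where "E \<in> sets M" "prob E > 1 - \<epsilon>"
    "\<And>\<omega>. \<omega> \<in> E \<Longrightarrow> susc w V (Count \<omega>) < ennreal K"
    "\<And>\<omega>. \<omega> \<in> E \<Longrightarrow> off_diag w H (Count \<omega>) < ennreal (\<epsilon>\<^sup>2 / 2)"
    "\<And>\<omega> k. \<omega> \<in> E \<Longrightarrow> k \<in> H \<Longrightarrow> c (k, k) \<omega> = 0"
    "\<And>\<omega> k u v. \<omega> \<in> E \<Longrightarrow> k \<in> H \<Longrightarrow> two_edges (Count \<omega>) k u v \<Longrightarrow> \<not> con (V - {k}) (Count \<omega>) u v"
    "\<And>\<omega>. \<omega> \<in> E \<Longrightarrow> (\<Sum>k. of_bool (k \<in> L) * through_sum w V (Count \<omega>) k) \<le> ennreal (2 * \<epsilon>\<^sub>1\<^sup>2)"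
proof -
  note T = T_nonneg
  define q where "q = \<epsilon>\<^sup>2 / 100"
  have q: "0 < q" "q \<le> \<epsilon> / 100" "q \<le> 1 / 100"
    using \<epsilon> by (auto simp: q_def power2_eq_square mult_le_one)
  \<comment> \<open>One denominator dominates 1, \<open>T\<close> and \<open>T^2 * K\<close>, so the
    single bound on \<open>H\<close> serves the small pairs, the loops and the cycles.\<close>
  define d where "d = 1 + T + K * T\<^sup>2"
  have d: "1 \<le> d" "T \<le> d" "T\<^sup>2 * K \<le> d"
    using T K by (auto simp: d_def mult.commute)
  define h where "h = q / d"
  have h0: "0 \<le> h" using q d by (simp add: h_def)
  have hd: "a * h \<le> q" if "a \<le> d" for a
  proof -
    have "a * h \<le> d * h" using that h0 by (rule mult_right_mono)
    also have "\<dots> = q" using d by (simp add: h_def)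
    finally show ?thesis .
  qed
  have h: "0 \<le> h" "h \<le> q" "T * h \<le> q" "T\<^sup>2 * K * h \<le> q"
    using h0 hd[of 1] hd[of T] hd[of "T\<^sup>2 * K"] d by simp_all
  have sH: "sq_sum w H \<le> ennreal h"
    using H by (simp add: h_def q_def d_def)
  have TsH: "ennreal T * sq_sum w H \<le> ennreal q"
  proof -
    have "ennreal T * sq_sum w H \<le> ennreal T * ennreal h" using sH by (rule mult_left_mono) simp
    also have "\<dots> \<le> ennreal q" using h T by (simp add: ennreal_mult[symmetric] ennreal_leI)
    finally show ?thesis .
  qed
  let ?P = "{\<omega> \<in> space M. ennreal K \<le> susc w V (Count \<omega>)}"
  let ?Q = "{\<omega> \<in> space M. ennreal (\<epsilon>\<^sup>2 / 2) \<le> off_diag w H (Count \<omega>)}"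
  let ?R = "{\<omega> \<in> space M. \<exists>k\<in>H. 1 \<le> c (k, k) \<omega>}"
  \<comment> \<open>The comparison with 1 puts the cycle event into the form of Markov's
    inequality.\<close>
  let ?S = "{\<omega> \<in> space M. ennreal 1 \<le> of_bool (susc w V (Count \<omega>) < ennreal K \<and>
       (\<exists>k\<in>H. \<exists>u v. two_edges (Count \<omega>) k u v \<and> con (V - {k}) (Count \<omega>) u v))}"
  let ?T = "{\<omega> \<in> space M. ennreal (2 * \<epsilon>\<^sub>1\<^sup>2) \<le> of_bool (susc w V (Count \<omega>) < ennreal K)
       * (\<Sum>k. of_bool (k \<in> L) * through_sum w V (Count \<omega>) k)}"
  have B1: "prob ?Q \<le> q"
  proof (rule prob_ge_le)
    have "(\<integral>\<^sup>+\<omega>. off_diag w H (Count \<omega>) \<partial>M) \<le> ennreal T * sq_sum w H * (2 * sq_sum w H)"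
      using TsH q by (intro nn_integral_off_diag_le order_trans[OF TsH] ennreal_leI) simp
    also have "\<dots> \<le> ennreal q * (2 * ennreal h)"
      using TsH sH by (intro mult_mono) auto
    also have "\<dots> = ennreal (q * (2 * h))"
      using q h by (simp add: ennreal_mult)
    also have "\<dots> \<le> ennreal (\<epsilon>\<^sup>2 / 2 * q)"
    proof (rule ennreal_leI)
      have "2 * h \<le> \<epsilon>\<^sup>2 / 2" using h q by (simp add: q_def)
      then have "q * (2 * h) \<le> q * (\<epsilon>\<^sup>2 / 2)" using q by (intro mult_left_mono) auto
      then show "q * (2 * h) \<le> \<epsilon>\<^sup>2 / 2 * q" by (simp add: mult.commute)
    qed
    finally show "(\<integral>\<^sup>+\<omega>. off_diag w H (Count \<omega>) \<partial>M) \<le> ennreal (\<epsilon>\<^sup>2 / 2 * q)" .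
  qed (use q \<epsilon> in auto)
  have B2: "prob ?R \<le> q"
    using order_trans[OF emeasure_loop_le[of H] TsH] q by (simp add: emeasure_eq_measure)
  have B3: "prob ?S \<le> q"
  proof (rule prob_ge_le)
    have "(\<integral>\<^sup>+\<omega>. of_bool (susc w V (Count \<omega>) < ennreal K \<and>
       (\<exists>k\<in>H. \<exists>u v. two_edges (Count \<omega>) k u v \<and> con (V - {k}) (Count \<omega>) u v)) \<partial>M)
       \<le> (ennreal T)\<^sup>2 * ennreal K * sq_sum w H"
      by (rule nn_integral_two_edges_con_le)
    also have "\<dots> \<le> (ennreal T)\<^sup>2 * ennreal K * ennreal h"
      using sH by (rule mult_left_mono) simp
    also have "\<dots> = ennreal (T\<^sup>2 * K * h)"
      using T K h by (simp add: ennreal_mult ennreal_power)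
    also have "\<dots> \<le> ennreal (1 * q)" using h by (intro ennreal_leI) simp
    finally show "(\<integral>\<^sup>+\<omega>. of_bool (susc w V (Count \<omega>) < ennreal K \<and>
       (\<exists>k\<in>H. \<exists>u v. two_edges (Count \<omega>) k u v \<and> con (V - {k}) (Count \<omega>) u v)) \<partial>M) \<le> ennreal (1 * q)" .
  qed (use q in auto)
  have B4: "prob ?T \<le> q"
  proof (rule prob_ge_le)
    define l where "l = 2 * \<epsilon>\<^sub>1\<^sup>2 * \<epsilon>\<^sup>2 / (100 * (1 + T * (K + 2))\<^sup>2)"
    have "(\<integral>\<^sup>+\<omega>. of_bool (susc w V (Count \<omega>) < ennreal K) * (\<Sum>k. of_bool (k \<in> L) * through_sum w V (Count \<omega>) k) \<partial>M)
        \<le> (1 + ennreal T * ennreal K)\<^sup>2 * sq_sum w L"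
      by (rule nn_integral_through_sum_le)
    also have "\<dots> \<le> (1 + ennreal T * ennreal K)\<^sup>2 * ennreal l"
      using L by (intro mult_left_mono) (auto simp: l_def)
    also have "\<dots> = ennreal ((1 + T * K)\<^sup>2 * l)"
    proof -
      have 1: "1 + ennreal T * ennreal K = ennreal (1 + T * K)"
        using T K by (simp add: ennreal_mult)
      have 2: "(ennreal (1 + T * K))\<^sup>2 = ennreal ((1 + T * K)\<^sup>2)"
        by (rule ennreal_power) (use T K in auto)
      show ?thesis
        unfolding 1 2 by (rule ennreal_mult[symmetric]) (auto simp: l_def)
    qed
    \<comment> \<open>Enlarging \<open>K\<close> to \<open>K + 2\<close> matches the denominator in
      the assumption on \<open>L\<close>.\<close>
    also have "(1 + T * K)\<^sup>2 * l \<le> (1 + T * (K + 2))\<^sup>2 * l"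
      using T K by (intro mult_right_mono power_mono) (auto simp: l_def algebra_simps)
    also have "\<dots> = 2 * \<epsilon>\<^sub>1\<^sup>2 * q"
    proof -
      have "1 + T * (K + 2) > 0" using T K by (intro add_pos_nonneg) auto
      then show ?thesis by (simp add: l_def q_def)
    qed
    finally show "(\<integral>\<^sup>+\<omega>. of_bool (susc w V (Count \<omega>) < ennreal K) * (\<Sum>k. of_bool (k \<in> L) * through_sum w V (Count \<omega>) k) \<partial>M)
        \<le> ennreal (2 * \<epsilon>\<^sub>1\<^sup>2 * q)" by (simp add: ennreal_leI)
  qed (use q \<epsilon>\<^sub>1 in auto)
  let ?U = "?P \<union> (?Q \<union> (?R \<union> (?S \<union> ?T)))"
  have S: "?P \<in> sets M" "?Q \<in> sets M" "?R \<in> sets M" "?S \<in> sets M" "?T \<in> sets M"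
    by measurable
  have B: "?U \<in> sets M" by (intro sets.Un S)
  have Un: "prob (X \<union> Y) \<le> a + b"
    if "X \<in> sets M" "Y \<in> sets M" "prob X \<le> a" "prob Y \<le> b" for X Y a b
    using that measure_Un_le[of X M Y] by linarith
  have "prob ?U \<le> \<epsilon> / 100 + (q + (q + (q + q)))"
    by (intro Un sets.Un S prob_K B1 B2 B3 B4)
  also have "\<dots> \<le> 5 * (\<epsilon> / 100)" using q by simp
  also have "\<dots> < \<epsilon>" using \<epsilon> by simp
  finally have EP: "prob (space M - ?U) > 1 - \<epsilon>"
    using B by (subst prob_compl) auto
  have ES: "space M - ?U \<in> sets M" using B by blast
  show ?thesis
  proof (rule that[OF ES EP])
    fix \<omega> assume \<omega>: "\<omega> \<in> space M - ?U"
    then show S: "susc w V (Count \<omega>) < ennreal K" by auto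
    show "off_diag w H (Count \<omega>) < ennreal (\<epsilon>\<^sup>2 / 2)" using \<omega> by (simp add: not_le)
    show "c (k, k) \<omega> = 0" if "k \<in> H" for k using \<omega> that by auto
    show "\<not> con (V - {k}) (Count \<omega>) u v" if "k \<in> H" "two_edges (Count \<omega>) k u v" for k u v
    proof
      assume "con (V - {k}) (Count \<omega>) u v"
      then have "\<exists>k\<in>H. \<exists>u v. two_edges (Count \<omega>) k u v \<and> con (V - {k}) (Count \<omega>) u v"
        using that by blast
      then have "\<omega> \<in> ?S" using \<omega> S by simp
      with \<omega> show False by blast
    qed
    show "(\<Sum>k. of_bool (k \<in> L) * through_sum w V (Count \<omega>) k) \<le> ennreal (2 * \<epsilon>\<^sub>1\<^sup>2)"
    proof (rule ccontr)
      assume "\<not> ?thesis"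
      then have "\<omega> \<in> ?T" using \<omega> S by (simp add: not_le less_imp_le)
      with \<omega> show False by blast
    qed
  qed
qed

end


section \<open>Multigraphs with given edge counts\<close>

lemma sym_adj: "sym (adj G)"
  by (auto simp: sym_def adj_def insert_commute)

lemma mem_component_of: "v \<in> verts G \<Longrightarrow> v \<in> component_of G v"
  by (simp add: component_of_def)

lemma component_of_eq:
  assumes "u \<in> component_of G v" shows "component_of G u = component_of G v"
proof -
  have "(v, u) \<in> (adj G)\<^sup>*" "(u, v) \<in> (adj G)\<^sup>*"
    using assms sym_rtrancl[OF sym_adj[of G]] by (auto simp: component_of_def dest: symD)
  then show ?thesis by (auto simp: component_of_def intro: rtrancl_trans)
qed

text \<open>One of the two factors in a squared size is expanded over the vertices of the component.
  After exchanging the sums, each vertex sees exactly one component, its own.\<close>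

lemma sum_sq_eq:
  fixes G :: "(nat, 'e) wmultigraph"
  shows "sum_sq G = (\<Sum>v. of_bool (v \<in> verts G) * (ennreal (weight G v) * comp_size G (component_of G v)))"
proof -
  let ?I = "\<lambda>C v. ennreal (weight G v) * comp_size G C * indicator (graph_components G) C * indicator C v"
  have "sum_sq G = (\<integral>\<^sup>+C. (\<integral>\<^sup>+v. ?I C v \<partial>count_space UNIV) \<partial>count_space UNIV)"
  proof -
    have "(\<integral>\<^sup>+v. ?I C v \<partial>count_space UNIV) = (comp_size G C)\<^sup>2 * indicator (graph_components G) C" for C
    proof -
      have "(\<integral>\<^sup>+v. ?I C v \<partial>count_space UNIV)
          = (\<integral>\<^sup>+v. (comp_size G C * indicator (graph_components G) C) * (ennreal (weight G v) * indicator C v) \<partial>count_space UNIV)"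
        by (intro nn_integral_cong) (simp add: mult_ac)
      also have "\<dots> = (comp_size G C * indicator (graph_components G) C) * comp_size G C"
        by (subst nn_integral_cmult) (simp_all add: comp_size_def nn_integral_count_space_indicator)
      finally show ?thesis by (simp add: power2_eq_square mult_ac)
    qed
    then show ?thesis by (simp add: sum_sq_def nn_integral_count_space_indicator)
  qed
  \<comment> \<open>Sets of vertices form an uncountable type, so the exchange goes through the
    Tonelli rules for counting measures, which hold without sigma-finiteness.\<close>
  also have "\<dots> = (\<integral>\<^sup>+v. (\<integral>\<^sup>+C. ?I C v \<partial>count_space UNIV) \<partial>count_space UNIV)"
    using nn_integral_fst_count_space[of "\<lambda>(C, v). ?I C v"] nn_integral_snd_count_space[of "\<lambda>(C, v). ?I C v"]
    by simp
  also have "\<dots> = (\<integral>\<^sup>+v. of_bool (v \<in> verts G) * (ennreal (weight G v) * comp_size G (component_of G v)) \<partial>count_space UNIV)"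
  proof (rule nn_integral_cong)
    fix v
    have "?I C v = of_bool (v \<in> verts G) * (ennreal (weight G v) * comp_size G C) * indicator {component_of G v} C" for C
      using component_of_eq[of v G] mem_component_of[of v G]
      by (auto simp: indicator_def graph_components_def component_of_def)
    then show "(\<integral>\<^sup>+C. ?I C v \<partial>count_space UNIV)
        = of_bool (v \<in> verts G) * (ennreal (weight G v) * comp_size G (component_of G v))"
      by simp
  qed
  also have "\<dots> = (\<Sum>v. of_bool (v \<in> verts G) * (ennreal (weight G v) * comp_size G (component_of G v)))"
    by (rule nn_integral_count_space_nat)
  finally show ?thesis .
qed

text \<open>The multigraph read off from deterministic edge counts. Weights vanish outside
  \<open>A\<close> to agree with truncated weight sequences.\<close>

definition count_graph ::
  "nat set \<Rightarrow> (nat \<times> nat \<Rightarrow> nat) \<Rightarrow> (nat \<Rightarrow> real) \<Rightarrow> (nat, nat \<times> nat \<times> nat) wmultigraph" where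
  "count_graph A f x = \<lparr>verts = A,
     edges = {(i, j, n). i \<in> A \<and> j \<in> A \<and> 1 \<le> n \<and> n \<le> f (i, j)},
     ends = (\<lambda>(i, j, n). {i, j}),
     weight = (\<lambda>i. if i \<in> A then x i else 0)\<rparr>"

lemma verts_count_graph [simp]: "verts (count_graph A f x) = A"
  by (simp add: count_graph_def)

lemma adj_count_graph: "adj (count_graph A f x) = {(u, v). u \<in> A \<and> v \<in> A \<and> edge f u v}"
proof -
  have "(\<exists>e. e \<in> edges (count_graph A f x) \<and> ends (count_graph A f x) e = {u, v}) \<longleftrightarrow> edge f u v"
    if "u \<in> A" "v \<in> A" for u v
  proof
    assume "edge f u v"
    then have "(u, v, 1) \<in> edges (count_graph A f x) \<or> (v, u, 1) \<in> edges (count_graph A f x)"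
      using that by (auto simp: edge_def count_graph_def)
    then show "\<exists>e. e \<in> edges (count_graph A f x) \<and> ends (count_graph A f x) e = {u, v}"
      by (auto simp: count_graph_def insert_commute)
  next
    assume "\<exists>e. e \<in> edges (count_graph A f x) \<and> ends (count_graph A f x) e = {u, v}"
    then show "edge f u v" by (auto simp: count_graph_def edge_def doubleton_eq_iff)
  qed
  then show ?thesis by (simp add: adj_def Bex_def del: split_paired_Ex cong: conj_cong)
qed

lemma component_of_count_graph:
  assumes "i \<in> A"
  shows "component_of (count_graph A f x) i = {j. con A f i j}"
proof -
  have "((i, j) \<in> (adj (count_graph A f x))\<^sup>*) = (\<lambda>u v. u \<in> A \<and> v \<in> A \<and> edge f u v)\<^sup>*\<^sup>* i j" for j
    unfolding adj_count_graph by (simp add: rtranclp_rtrancl_eq)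
  then show ?thesis using assms by (auto simp: component_of_def con_def count_graph_def)
qed

lemma graph_components_count_graph:
  "graph_components (count_graph A f x) = (\<lambda>i. {j. con A f i j}) ` A"
  by (simp add: graph_components_def component_of_count_graph cong: image_cong)

lemma comp_size_count_graph:
  assumes "i \<in> A"
  shows "comp_size (count_graph A f x) {j. con A f i j} = csize (\<lambda>i. ennreal (x i)) A f i"
proof -
  have "comp_size (count_graph A f x) {j. con A f i j}
      = (\<integral>\<^sup>+j. ennreal (x j) * of_bool (con A f i j) \<partial>count_space UNIV)"
    unfolding comp_size_def
    by (subst nn_integral_count_space_indicator)
      (auto simp: count_graph_def indicator_def intro!: nn_integral_cong dest: con_in)
  then show ?thesis by (simp add: csize_def nn_integral_count_space_nat)
qed

lemma sum_sq_count_graph: "sum_sq (count_graph A f x) = susc (\<lambda>i. ennreal (x i)) A f"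
  unfolding sum_sq_eq susc_def
proof (intro arg_cong[where f = suminf] ext)
  fix i
  show "of_bool (i \<in> verts (count_graph A f x)) * (ennreal (weight (count_graph A f x) i)
      * comp_size (count_graph A f x) (component_of (count_graph A f x) i))
    = ennreal (x i) * csize (\<lambda>i. ennreal (x i)) A f i"
    by (cases "i \<in> A")
      (simp_all add: component_of_count_graph comp_size_count_graph csize_outside, simp_all add: count_graph_def)
qed

section \<open>Cycles and double edges in terms of counts\<close>

text \<open>For \<open>u = v\<close>, edges with the same orientation have different indices, so
  that count is at least 2; edges of opposite orientations contribute at least 1 to each of the two
  counts.\<close>

lemma two_edges_count_graph:
  assumes "e \<in> edges (count_graph A f x)" "e' \<in> edges (count_graph A f x)" "e \<noteq> e'"
    and "ends (count_graph A f x) e = {k, u}" "ends (count_graph A f x) e' = {k, v}"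
    and "u \<noteq> k" "v \<noteq> k"
  shows "two_edges f k u v"
proof -
  obtain i j n where e: "e = (i, j, n)" by (cases e)
  obtain i' j' n' where e': "e' = (i', j', n')" by (cases e')
  have n: "1 \<le> n" "n \<le> f (i, j)" "1 \<le> n'" "n' \<le> f (i', j')" "i = k \<and> j = u \<or> i = u \<and> j = k"
    "i' = k \<and> j' = v \<or> i' = v \<and> j' = k" "(i, j) = (i', j') \<Longrightarrow> n \<noteq> n'"
    using assms by (auto simp: e e' count_graph_def doubleton_eq_iff)
  show ?thesis
  proof (cases "u = v")
    case True
    have "(i, j) = (i', j') \<Longrightarrow> 2 \<le> f (i, j)" using n by auto
    then show ?thesis using n True \<open>u \<noteq> k\<close> by (auto simp: two_edges_def)
  next
    case False
    then show ?thesis using n by (auto simp: two_edges_def edge_def)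
  qed
qed

lemma edge_count_graph:
  assumes "e \<in> edges (count_graph A f x)" "ends (count_graph A f x) e = {u, v}"
  shows "u \<in> A" "v \<in> A" "edge f u v"
  using assms by (auto simp: count_graph_def edge_def doubleton_eq_iff)

text \<open>A cycle of length 1 is a loop at \<open>k\<close>. In a longer one, the other vertices
  form a path avoiding \<open>k\<close>, whose first and last vertices are joined to
  \<open>k\<close> by the two distinct cycle edges at \<open>k\<close>. For length 2 these vertices
  coincide and the edges are parallel.\<close>

lemma cycle_count_graph:
  assumes "is_cycle (count_graph A f x) vs es" "k \<in> set vs"
  shows "0 < f (k, k) \<or> (\<exists>u v. two_edges f k u v \<and> con (A - {k}) f u v)"
proof -
  let ?G = "count_graph A f x" and ?m = "length vs"
  have len: "length es = ?m" and dvs: "distinct vs" and des: "distinct es"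
    and vA: "set vs \<subseteq> A" and eE: "set es \<subseteq> edges ?G"
    and ends: "\<And>l. l < ?m \<Longrightarrow> ends ?G (es ! l) = {vs ! l, vs ! (Suc l mod ?m)}"
    using assms(1) by (simp_all add: is_cycle_def)
  obtain l where l: "l < ?m" "vs ! l = k" using assms(2) by (auto simp: in_set_conv_nth)
  have vsA: "vs ! a \<in> A" if "a < ?m" for a
    using subsetD[OF vA nth_mem[OF that]] .
  have esE: "es ! a \<in> edges ?G" if "a < ?m" for a
    using subsetD[OF eE nth_mem[of a es]] that len by simp
  have edge: "edge f (vs ! a) (vs ! (Suc a mod ?m))" if "a < ?m" for a
    by (rule edge_count_graph(3)[OF esE[OF that] ends[OF that]])
  show ?thesis
  proof (cases "?m = 1")
    case True
    then show ?thesis using edge[OF l(1)] l by (auto simp: edge_def)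
  next
    case False
    then have m2: "2 \<le> ?m" using l by auto
    \<comment> \<open>The position of the \<open>a\<close>-th vertex after \<open>k\<close> in
      cyclic order, starting from \<open>a = 0\<close>; it differs from \<open>l\<close> as long as
      \<open>a + 1 < ?m\<close>.\<close>
    define p where "p a = (l + 1 + a) mod ?m" for a
    have pm: "p a < ?m" for a unfolding p_def by (rule mod_less_divisor) (use m2 in linarith)
    have p_eq: "p a = (if l + 1 + a < ?m then l + 1 + a else l + 1 + a - ?m)" if "a + 1 < ?m" for a
    proof (cases "l + 1 + a < ?m")
      case False
      have "p a = (l + 1 + a - ?m) mod ?m"
        unfolding p_def by (rule le_mod_geq) (use False in simp)
      also have "\<dots> = l + 1 + a - ?m"
        by (rule mod_less) (use that l in linarith)
      finally show ?thesis using False by simp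
    qed (simp add: p_def)
    have pl: "p a \<noteq> l" if "a + 1 < ?m" for a
      unfolding p_eq[OF that] using that l by (simp split: if_split; linarith)
    have nk: "vs ! p a \<noteq> k" if "a + 1 < ?m" for a
      using pl[OF that] pm[of a] l dvs nth_eq_iff_index_eq by metis
    have step: "Suc (p a) mod ?m = p (Suc a)" for a
      by (simp add: p_def mod_Suc_eq)
    have con: "con (A - {k}) f (vs ! p 0) (vs ! p a)" if "a + 1 < ?m" for a
      using that
    proof (induction a)
      case 0
      then show ?case using nk[of 0] vsA[OF pm[of 0]] by (intro con_refl) auto
    next
      case (Suc a)
      have "con (A - {k}) f (vs ! p a) (vs ! p (Suc a))"
        using edge[OF pm[of a]] nk[of a] nk[of "Suc a"] Suc.prems vsA[OF pm[of a]] vsA[OF pm[of "Suc a"]]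
        by (intro con_edge) (simp_all add: step)
      then show ?case using Suc con_trans by auto
    qed
    \<comment> \<open>The last vertex before the cycle returns to \<open>k\<close>; for length 2 it
      is also the first one.\<close>
    define a where "a = ?m - 2"
    have a: "a + 1 < ?m" using m2 by (simp add: a_def)
    have pa: "Suc (p a) mod ?m = l"
    proof (cases "l = 0")
      case True
      then have "Suc (p a) = ?m" unfolding p_eq[OF a] using m2 a_def by auto
      then show ?thesis using True by simp
    next
      case False
      then have "Suc (p a) = l" unfolding p_eq[OF a] using m2 l a_def by auto
      then show ?thesis using l by simp
    qed
    have ends_l: "ends ?G (es ! l) = {k, vs ! p 0}"
      using ends[OF l(1)] l by (simp add: p_def)
    have ends_p: "ends ?G (es ! p a) = {k, vs ! p a}"
      using ends[OF pm[of a]] pa l by (simp add: insert_commute)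
    have "es ! l \<noteq> es ! p a"
      using des pl[OF a] pm[of a] l len by (metis nth_eq_iff_index_eq)
    then have "two_edges f k (vs ! p 0) (vs ! p a)"
      using nk[of 0] nk[of a] a
      by (intro two_edges_count_graph[OF esE[OF l(1)] esE[OF pm] _ ends_l ends_p]) auto
    then show ?thesis using con[OF a] by blast
  qed
qed

text \<open>Two edges between the components close a cycle through the end point \<open>u\<close> of
  one of them in \<open>H\<close>. If both start at \<open>u\<close>, their other ends are connected
  in \<open>B\<close>, hence without \<open>u\<close>. Otherwise the second edge at \<open>u\<close>
  is the first step of a path in \<open>H\<close> from \<open>u\<close> to \<open>v\<close>,
  continued by the other edge and a path in \<open>B\<close>.\<close>

lemma joins_unique_count_graph:
  assumes HB: "H \<subseteq> V" "B \<subseteq> V" "H \<inter> B = {}" and a: "a \<in> H" and b: "b \<in> B"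
    and no: "\<And>k u v. k \<in> H \<Longrightarrow> two_edges f k u v \<Longrightarrow> \<not> con (V - {k}) f u v"
  shows "\<exists>\<^sub>\<le>\<^sub>1 e. joins (count_graph V f x) e {j. con H f a j} {j. con B f b j}"
proof (rule Uniq_I, rule ccontr)
  fix e e'
  assume e: "joins (count_graph V f x) e {j. con H f a j} {j. con B f b j}"
    and e': "joins (count_graph V f x) e' {j. con H f a j} {j. con B f b j}"
    and ne: "e \<noteq> e'"
  obtain u u' where u: "con H f a u" "con B f b u'" "ends (count_graph V f x) e = {u, u'}"
    "e \<in> edges (count_graph V f x)"
    using e by (auto simp: joins_def)
  obtain v v' where v: "con H f a v" "con B f b v'" "ends (count_graph V f x) e' = {v, v'}"
    "e' \<in> edges (count_graph V f x)"
    using e' by (auto simp: joins_def)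
  have inH: "u \<in> H" "v \<in> H" and inB: "u' \<in> B" "v' \<in> B" using u v con_in by blast+
  have uv: "con H f u v" and vu': "con B f v' u'" using u v con_sym con_trans by blast+
  have vu: "con (V - {u}) f v' u'" by (rule con_mono[OF vu']) (use HB inH in auto)
  show False
  proof (cases "u = v")
    case True
    have "two_edges f u u' v'"
      using u v ne True inH inB HB by (intro two_edges_count_graph[of e V f x e']) auto
    then show False using no[OF inH(1)] vu con_sym by blast
  next
    case False
    obtain w where w: "edge f u w" "con (H - {u}) f w v" using con_first_step[OF uv False] .
    have "con (V - {u}) f w v" by (rule con_mono[OF w(2)]) (use HB in auto)
    moreover have "con (V - {u}) f v v'"
      using edge_count_graph[OF v(4,3)] False inH inB HB by (intro con_edge) auto
    ultimately have "con (V - {u}) f w u'" using vu con_trans by blast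
    moreover have "w \<noteq> u'" using con_in(1)[OF w(2)] inB HB by auto
    then have "two_edges f u w u'"
      using w edge_count_graph(3)[OF u(4,3)] by (simp add: two_edges_def)
    ultimately show False using no[OF inH(1)] by blast
  qed
qed


section \<open>Poisson edge counts\<close>

text \<open>Points are counted in a bounded interval of positive reals, as the Poisson law is
  prescribed on \<open>bounded_borel\<close>.\<close>

definition mg_count :: "(nat \<times> nat \<Rightarrow> 'w \<Rightarrow> real set) \<Rightarrow> (nat \<Rightarrow> real) \<Rightarrow> real \<Rightarrow> 'w \<Rightarrow> nat \<times> nat \<Rightarrow> nat" where
  "mg_count N x t \<omega> p = card (N p \<omega> \<inter> {0<..t / 2 * x (fst p) * x (snd p)})"

lemma config_Int_atMost: "A \<in> configurations \<Longrightarrow> A \<inter> {..s} = A \<inter> {0<..s}"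
  by (auto simp: configurations_def)

text \<open>\<open>jump_time_le_iff\<close> turns conditions on jump times into conditions on
  counts. Setting weights to 0 outside \<open>A\<close> amounts to deleting vertices, so the full
  and the truncated graphs all use the same counts of \<open>x\<close>.\<close>

lemma MG_eq_count_graph:
  assumes "\<And>p. N p \<omega> \<in> configurations" "A \<subseteq> {i. 0 < x i}"
  shows "MG N \<omega> (\<lambda>i. if i \<in> A then x i else 0) t = count_graph A (mg_count N x t \<omega>) x"
proof -
  have "jump_time (N (i, j) \<omega>) n \<le> ereal (t / 2 * x i * x j) \<longleftrightarrow> n \<le> mg_count N x t \<omega> (i, j)"
    if "1 \<le> n" for i j n
    using jump_time_le_iff[OF assms(1) that] config_Int_atMost[OF assms(1)] by (simp add: mg_count_def)
  then show ?thesis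
    using assms(2) unfolding MG_def count_graph_def by (auto split: if_splits)
qed

lemma mg_count_mono:
  assumes "\<And>p. N p \<omega> \<in> configurations" "\<And>i. 0 \<le> x i" "s \<le> t"
  shows "mg_count N x s \<omega> \<le> mg_count N x t \<omega>"
proof (rule le_funI)
  fix p
  \<comment> \<open>Monotonicity of \<open>card\<close> needs finiteness, since \<open>card\<close>
    is 0 on infinite sets.\<close>
  have "finite (N p \<omega> \<inter> {0<..t / 2 * x (fst p) * x (snd p)})"
    using assms(1)[of p] config_Int_atMost[OF assms(1)] by (metis (no_types, lifting) configurations_def mem_Collect_eq)
  moreover have "s / 2 * x (fst p) * x (snd p) \<le> t / 2 * x (fst p) * x (snd p)"
    using assms by (intro mult_right_mono) auto
  ultimately show "mg_count N x s \<omega> p \<le> mg_count N x t \<omega> p"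
    unfolding mg_count_def by (intro card_mono) auto
qed

lemma space_config_space: "space config_space = configurations"
  by (simp add: config_space_def space_measure_of_conv)

lemma measurable_card_Int:
  assumes "B \<in> bounded_borel"
  shows "(\<lambda>A. card (A \<inter> B)) \<in> measurable config_space (count_space UNIV)"
proof (subst measurable_count_space_eq2_countable)
  have "(\<lambda>A. card (A \<inter> B)) -` {k} \<inter> space config_space = {A \<in> configurations. card (A \<inter> B) = k}" for k
    by (auto simp: space_config_space)
  moreover have "{A \<in> configurations. card (A \<inter> B) = k} \<in> sets config_space" for k
    unfolding config_space_def using assms by (intro in_measure_of) auto
  ultimately show "(\<lambda>A. card (A \<inter> B)) \<in> space config_space \<rightarrow> UNIV \<and>
      (\<forall>a\<in>UNIV. (\<lambda>A. card (A \<inter> B)) -` {a} \<inter> space config_space \<in> sets config_space)"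
    by simp
qed

lemma bounded_borel_Ioc: "{0<..s} \<in> bounded_borel"
  by (auto simp: bounded_borel_def intro: bounded_subset[OF bounded_cbox[of 0 s]])

text \<open>Both bounds come from \<open>1 - s \<le> exp (- s)\<close>; the second uses
  \<open>1 - (1 + s) * (1 - s) = s^2\<close>.\<close>

lemma poisson_count_bounds:
  assumes "prob_space M" and X: "poisson_point_process M X" and s: "0 \<le> s"
  shows "measure M {\<omega> \<in> space M. 1 \<le> card (X \<omega> \<inter> {0<..s})} \<le> s"
    and "measure M {\<omega> \<in> space M. 2 \<le> card (X \<omega> \<inter> {0<..s})} \<le> s\<^sup>2"
proof -
  interpret prob_space M by fact
  let ?c = "\<lambda>\<omega>. card (X \<omega> \<inter> {0<..s})"
  have "X \<in> measurable M config_space" using X by (simp add: poisson_point_process_def)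
  then have [measurable]: "?c \<in> measurable M (count_space UNIV)"
    using measurable_compose[OF _ measurable_card_Int[OF bounded_borel_Ioc]] by blast
  have P: "prob {\<omega> \<in> space M. ?c \<omega> = k} = s ^ k / fact k * exp (- s)" for k
    using X bounded_borel_Ioc[of s] s unfolding poisson_point_process_def by simp
  have e: "1 - s \<le> exp (- s)" using exp_ge_add_one_self[of "- s"] by simp
  have "{\<omega> \<in> space M. 1 \<le> ?c \<omega>} = space M - {\<omega> \<in> space M. ?c \<omega> = 0}" by auto
  then have "prob {\<omega> \<in> space M. 1 \<le> ?c \<omega>} = 1 - exp (- s)"
    using P[of 0] by (simp add: prob_compl)
  then show "prob {\<omega> \<in> space M. 1 \<le> ?c \<omega>} \<le> s" using e by simp
  have "{\<omega> \<in> space M. 2 \<le> ?c \<omega>} = space M - ({\<omega> \<in> space M. ?c \<omega> = 0} \<union> {\<omega> \<in> space M. ?c \<omega> = 1})"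
    by auto
  moreover have "prob ({\<omega> \<in> space M. ?c \<omega> = 0} \<union> {\<omega> \<in> space M. ?c \<omega> = 1}) = exp (- s) + s * exp (- s)"
    using P[of 0] P[of 1] by (subst finite_measure_Union) auto
  ultimately have "prob {\<omega> \<in> space M. 2 \<le> ?c \<omega>} = 1 - (1 + s) * exp (- s)"
    by (simp add: prob_compl algebra_simps)
  also have "\<dots> \<le> 1 - (1 + s) * (1 - s)"
    using e s by (intro diff_left_mono mult_left_mono) auto
  also have "\<dots> = s\<^sup>2" by (simp add: power2_eq_square algebra_simps)
  finally show "prob {\<omega> \<in> space M. 2 \<le> ?c \<omega>} \<le> s\<^sup>2" .
qed

lemma random_multigraph_mg_count:
  assumes M: "prob_space M" and N: "\<And>p. poisson_point_process M (N p)"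
    and indep: "prob_space.indep_vars M (\<lambda>_. config_space) N UNIV"
    and x: "\<And>i. 0 \<le> x i" and T: "0 \<le> T"
  shows "random_multigraph M (\<lambda>p \<omega>. mg_count N x T \<omega> p) x T"
proof -
  interpret prob_space M by fact
  show ?thesis
  proof
    show "indep_vars (\<lambda>_. count_space UNIV) (\<lambda>p \<omega>. mg_count N x T \<omega> p) UNIV"
      unfolding mg_count_def
      by (rule indep_vars_compose2[OF indep]) (rule measurable_card_Int[OF bounded_borel_Ioc])
    have s: "0 \<le> T / 2 * x i * x j" for i j using x T by simp
    show "prob {\<omega> \<in> space M. 1 \<le> mg_count N x T \<omega> (i, j)} \<le> T / 2 * x i * x j" for i j
      unfolding mg_count_def fst_conv snd_conv by (rule poisson_count_bounds(1)[OF M N s])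
    show "prob {\<omega> \<in> space M. 2 \<le> mg_count N x T \<omega> (i, j)} \<le> (T / 2 * x i * x j)\<^sup>2" for i j
      unfolding mg_count_def fst_conv snd_conv by (rule poisson_count_bounds(2)[OF M N s])
  qed (use x T in auto)
qed


section \<open>The main estimate\<close>

theorem lemma5p5:
  fixes M :: "'w measure"
    and N :: "nat \<times> nat \<Rightarrow> 'w \<Rightarrow> real set"
    and x :: "nat \<Rightarrow> real"
    and T \<epsilon> \<epsilon>\<^sub>1 \<epsilon>\<^sub>2 K :: real
  assumes "prob_space M"
    and "\<And>p. poisson_point_process M (N p)"
    and "prob_space.indep_vars M (\<lambda>_. config_space) N UNIV"
    and "\<And>i. 0 \<le> x i" and "summable (\<lambda>i. (x i)\<^sup>2)"
    and "0 \<le> T" and "0 < \<epsilon>" and "\<epsilon> < 1"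
    and "1 \<le> K"
    and "measure M {\<omega> \<in> space M. sum_sq (MG N \<omega> x T) \<ge> ennreal K} \<le> \<epsilon> / 100"
    and "0 < \<epsilon>\<^sub>1" and "\<epsilon>\<^sub>1 < \<epsilon>"
    and "\<forall>\<omega>\<in>space M. sum_sq (MG N \<omega> (trunc_le \<epsilon>\<^sub>1 x) 0)
           \<le> ennreal (\<epsilon>\<^sup>2 / (100 * (1 + T + K * T\<^sup>2)))"
    and "0 < \<epsilon>\<^sub>2" and "\<epsilon>\<^sub>2 < \<epsilon>\<^sub>1"
    and "\<forall>\<omega>\<in>space M. sum_sq (MG N \<omega> (trunc_le \<epsilon>\<^sub>2 x) 0)
           \<le> ennreal (2 * \<epsilon>\<^sub>1\<^sup>2 * \<epsilon>\<^sup>2 / (100 * (1 + T * (K + 2))\<^sup>2))"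
  shows "\<exists>E\<in>sets M. measure M E > 1 - \<epsilon> \<and>
    (\<forall>\<omega>\<in>E. \<forall>t. 0 \<le> t \<and> t \<le> T \<longrightarrow>
      (\<forall>C\<in>graph_components (MG N \<omega> x t). comp_size (MG N \<omega> x t) C > ennreal \<epsilon> \<longrightarrow>
         (\<exists>m\<in>graph_components (MG N \<omega> x 0). comp_size (MG N \<omega> x 0) m > ennreal \<epsilon>\<^sub>1 \<and> m \<subseteq> C)) \<and>
      (\<forall>m\<in>graph_components (MG N \<omega> (trunc_le \<epsilon>\<^sub>1 x) 0).
         \<not> (\<exists>vs es. is_cycle (MG N \<omega> x t) vs es \<and> m \<subseteq> set vs)) \<and>
      (\<forall>m\<in>graph_components (MG N \<omega> (trunc_le \<epsilon>\<^sub>1 x) t). \<forall>m'\<in>graph_components (MG N \<omega> (trunc_gt \<epsilon>\<^sub>1 x) t).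
         \<exists>\<^sub>\<le>\<^sub>1 e. joins (MG N \<omega> x t) e m m') \<and>
      sum_sq (MG N \<omega> x t) - sum_sq (MG N \<omega> (trunc_gt \<epsilon>\<^sub>2 x) t) \<le> ennreal (2 * \<epsilon>\<^sub>1\<^sup>2) \<and>
      (\<forall>i. {i} \<in> graph_components (MG N \<omega> x 0) \<and> comp_size (MG N \<omega> x 0) {i} > ennreal \<epsilon>\<^sub>1 \<longrightarrow>
         comp_size (MG N \<omega> x t) (component_of (MG N \<omega> x t) i)
           - comp_size (MG N \<omega> (trunc_gt \<epsilon>\<^sub>2 x) t) (component_of (MG N \<omega> (trunc_gt \<epsilon>\<^sub>2 x) t) i)
         < ennreal \<epsilon>\<^sub>1))"
proof -
  note x = assms(4) and T = assms(6) and \<epsilon> = assms(7,8) and K = assms(9)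
    and \<epsilon>\<^sub>1 = assms(11,12) and \<epsilon>\<^sub>2 = assms(14,15)
  interpret prob_space M by fact
  interpret random_multigraph M "\<lambda>p \<omega>. mg_count N x T \<omega> p" x T
    by (rule random_multigraph_mg_count) fact+
  have Count: "Count \<omega> = mg_count N x T \<omega>" for \<omega>
    by (simp add: Count_def fun_eq_iff)
  have w: "(\<lambda>i. ennreal (x i)) = w"
    by (simp add: w_def fun_eq_iff)
  \<comment> \<open>The vertex sets of the five graphs in the statement; all of them will share the
    counts of \<open>x\<close>.\<close>
  define V where "V = {i. 0 < x i}"
  define H where "H = {i. 0 < x i \<and> x i \<le> \<epsilon>\<^sub>1}"
  define B where "B = {i. \<epsilon>\<^sub>1 < x i}"
  define L where "L = {i. 0 < x i \<and> x i \<le> \<epsilon>\<^sub>2}"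
  define V2 where "V2 = {i. \<epsilon>\<^sub>2 < x i}"
  have conf: "N p \<omega> \<in> configurations" if "\<omega> \<in> space M" for p \<omega>
  proof -
    have "N p \<in> measurable M config_space"
      using assms(2)[of p] by (simp add: poisson_point_process_def)
    from measurable_space[OF this that] show ?thesis by (simp add: space_config_space)
  qed
  have sub: "V \<subseteq> {i. 0 < x i}" "H \<subseteq> {i. 0 < x i}" "B \<subseteq> {i. 0 < x i}" "L \<subseteq> {i. 0 < x i}" "V2 \<subseteq> {i. 0 < x i}"
    using \<epsilon>\<^sub>1 \<epsilon>\<^sub>2 by (auto simp: V_def H_def B_def L_def V2_def)
  have x_eq: "x = (\<lambda>i. if i \<in> V then x i else 0)"
    "trunc_le \<epsilon>\<^sub>1 x = (\<lambda>i. if i \<in> H then x i else 0)"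
    "trunc_gt \<epsilon>\<^sub>1 x = (\<lambda>i. if i \<in> B then x i else 0)"
    "trunc_le \<epsilon>\<^sub>2 x = (\<lambda>i. if i \<in> L then x i else 0)"
    "trunc_gt \<epsilon>\<^sub>2 x = (\<lambda>i. if i \<in> V2 then x i else 0)"
    using x by (auto simp: fun_eq_iff V_def H_def B_def L_def V2_def trunc_le_def trunc_gt_def order.order_iff_strict)
  have MG_eq: "MG N \<omega> y t = count_graph A (mg_count N x t \<omega>) x"
    if "\<omega> \<in> space M" "y = (\<lambda>i. if i \<in> A then x i else 0)" "A \<subseteq> {i. 0 < x i}" for y A t \<omega>
    unfolding that(2) by (rule MG_eq_count_graph) (use that conf in auto)
  note MG = MG_eq[OF _ x_eq(1) sub(1)] MG_eq[OF _ x_eq(2) sub(2)] MG_eq[OF _ x_eq(3) sub(3)]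
    MG_eq[OF _ x_eq(4) sub(4)] MG_eq[OF _ x_eq(5) sub(5)]
  \<comment> \<open>The assumptions at time 0 range over sample points, but \<open>sq_sum\<close> is
    deterministic, so one sample point yields the numerical bounds.\<close>
  obtain \<omega>\<^sub>0 where \<omega>\<^sub>0: "\<omega>\<^sub>0 \<in> space M" using not_empty by blast
  have sq_le: "sq_sum w A \<le> sum_sq (count_graph A f x)" for A f
    unfolding sum_sq_count_graph w susc_eq by simp
  have sH: "sq_sum w H \<le> ennreal (\<epsilon>\<^sup>2 / (100 * (1 + T + K * T\<^sup>2)))"
    using order_trans[OF sq_le assms(13)[rule_format, OF \<omega>\<^sub>0, unfolded MG(2)[OF \<omega>\<^sub>0]]] .
  have sL: "sq_sum w L \<le> ennreal (2 * \<epsilon>\<^sub>1\<^sup>2 * \<epsilon>\<^sup>2 / (100 * (1 + T * (K + 2))\<^sup>2))"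
    using order_trans[OF sq_le assms(16)[rule_format, OF \<omega>\<^sub>0, unfolded MG(4)[OF \<omega>\<^sub>0]]] .
  have "{\<omega> \<in> space M. ennreal K \<le> susc w V (Count \<omega>)} = {\<omega> \<in> space M. sum_sq (MG N \<omega> x T) \<ge> ennreal K}"
    by (auto simp: MG sum_sq_count_graph w Count)
  then have pK: "prob {\<omega> \<in> space M. ennreal K \<le> susc w V (Count \<omega>)} \<le> \<epsilon> / 100"
    using assms(10) by simp
  show ?thesis
  proof (rule good_event[OF \<epsilon> K \<epsilon>\<^sub>1(1) pK sH sL])
    fix E assume E: "E \<in> sets M" "prob E > 1 - \<epsilon>"
      and E0: "\<And>\<omega>. \<omega> \<in> E \<Longrightarrow> susc w V (Count \<omega>) < ennreal K"
      and E1: "\<And>\<omega>. \<omega> \<in> E \<Longrightarrow> off_diag w H (Count \<omega>) < ennreal (\<epsilon>\<^sup>2 / 2)"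
      and E2: "\<And>\<omega> k. \<omega> \<in> E \<Longrightarrow> k \<in> H \<Longrightarrow> mg_count N x T \<omega> (k, k) = 0"
      and E3: "\<And>\<omega> k u v. \<omega> \<in> E \<Longrightarrow> k \<in> H \<Longrightarrow> two_edges (Count \<omega>) k u v \<Longrightarrow> \<not> con (V - {k}) (Count \<omega>) u v"
      and E4: "\<And>\<omega>. \<omega> \<in> E \<Longrightarrow> (\<Sum>k. of_bool (k \<in> L) * through_sum w V (Count \<omega>) k) \<le> ennreal (2 * \<epsilon>\<^sub>1\<^sup>2)"
    show ?thesis
    proof (intro bexI[OF _ E(1)] conjI[OF E(2)] ballI allI impI)
      fix \<omega> t assume \<omega>E: "\<omega> \<in> E" and t: "0 \<le> t \<and> t \<le> T"
      have \<omega>: "\<omega> \<in> space M" using sets.sets_into_space[OF E(1)] \<omega>E by blast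
      define f where "f = mg_count N x t \<omega>"
      define g where "g = Count \<omega>"
      \<comment> \<open>The good event concerns time \<open>T\<close>. Connections, component sizes,
        double edges and \<open>through_sum\<close> increase with the counts, so its upper bounds
        and exclusions also hold at time \<open>t\<close>.\<close>
      have fg: "f \<le> g" unfolding f_def g_def Count using t by (intro mg_count_mono conf \<omega> x) auto
      note MG = MG[OF \<omega>]
      have comps0: "graph_components (MG N \<omega> y 0) = (\<lambda>i. {i}) ` {i. 0 < y i}" for y
        by (rule graph_components_MG_0) (rule conf[OF \<omega>])
      have size0: "comp_size (MG N \<omega> x 0) {i} = ennreal (x i)" for i
        by (simp add: comp_size_def MG_def nn_integral_count_space_finite)
      have no: "\<not> con (V - {k}) f u v" if "k \<in> H" "two_edges f k u v" for k u v
        using E3[OF \<omega>E that(1), of u v] two_edges_mono[OF that(2) fg] con_mono[OF _ order_refl fg]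
        by (auto simp: g_def)
      \<comment> \<open>Finiteness makes the differences of sizes and of sums of squares in
        \<open>ennreal\<close> genuine.\<close>
      have fin: "susc w V f < \<infinity>"
        using le_less_trans[OF susc_mono[OF order_refl fg] E0[OF \<omega>E, folded g_def]]
        by (auto intro: less_trans)
      have V2V: "V2 \<subseteq> V" "V - V2 = L" "H \<subseteq> V" "B \<subseteq> V" "H \<inter> B = {}"
        using \<epsilon>\<^sub>1 \<epsilon>\<^sub>2 by (auto simp: V_def V2_def L_def H_def B_def)
      have thr: "(\<Sum>k. of_bool (k \<in> V - V2) * through_sum w V f k) \<le> ennreal (2 * \<epsilon>\<^sub>1\<^sup>2)"
        unfolding V2V(2) using E4[OF \<omega>E] through_sum_mono[OF fg]
        by (intro order_trans[OF suminf_ennreal_mono[OF mult_left_mono] E4[OF \<omega>E]]) (auto simp: g_def)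
      have a: "\<exists>m\<in>graph_components (MG N \<omega> x 0). comp_size (MG N \<omega> x 0) m > ennreal \<epsilon>\<^sub>1 \<and> m \<subseteq> C"
        if C: "C \<in> graph_components (MG N \<omega> x t)" "comp_size (MG N \<omega> x t) C > ennreal \<epsilon>" for C
      proof -
        obtain i where i: "i \<in> V" "C = {j. con V f i j}"
          using C(1) by (auto simp: MG graph_components_count_graph f_def)
        have size: "ennreal \<epsilon> < csize w V f i"
          using C(2) i by (simp add: MG comp_size_count_graph f_def w)
        have "\<exists>j. con V f i j \<and> \<epsilon>\<^sub>1 < x j"
        proof (rule ccontr)
          \<comment> \<open>Then the whole component consists of small vertices and is a component
            of the graph on \<open>H\<close>. Its squared size is at most
            \<open>\<epsilon>^2 / 100\<close> from the diagonal plus \<open>\<epsilon>^2 / 2\<close>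
            from distinct pairs, which is less than \<open>\<epsilon>^2\<close>.\<close>
          assume "\<not> ?thesis"
          then have "con H f i j" if "con V f i j" for j
            using con_in(2)[of V f i]
              by (intro con_restrict[OF that]) (auto simp: H_def V_def not_less)
          then have "csize w V f i \<le> csize w H f i"
            unfolding csize_def by (intro suminf_ennreal_mono mult_left_mono) auto
          also have "\<dots> \<le> csize w H g i" by (rule csize_mono[OF order_refl fg])
          finally have "ennreal \<epsilon> \<le> csize w H g i" using size by simp
          then have "(ennreal \<epsilon>)\<^sup>2 \<le> (csize w H g i)\<^sup>2" by (rule power_mono) simp
          also have "\<dots> \<le> susc w H g" by (rule csize_square_le_susc)
          also have "\<dots> \<le> ennreal (\<epsilon>\<^sup>2 / 100) + ennreal (\<epsilon>\<^sup>2 / 2)"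
          proof -
            have "0 \<le> K * T\<^sup>2" using K by simp
            then have "\<epsilon>\<^sup>2 / (100 * (1 + T + K * T\<^sup>2)) \<le> \<epsilon>\<^sup>2 / 100"
              using T by (intro divide_left_mono) auto
            then have "sq_sum w H \<le> ennreal (\<epsilon>\<^sup>2 / 100)"
              using order_trans[OF sH] ennreal_leI by blast
            then show ?thesis
              unfolding susc_eq using E1[OF \<omega>E] by (intro add_mono) (auto simp: g_def)
          qed
          also have "\<dots> = ennreal (\<epsilon>\<^sup>2 / 100 + \<epsilon>\<^sup>2 / 2)"
            by (rule ennreal_plus[symmetric]) auto
          finally have "ennreal (\<epsilon>\<^sup>2) \<le> ennreal (\<epsilon>\<^sup>2 / 100 + \<epsilon>\<^sup>2 / 2)"
            using \<epsilon> by (simp only: ennreal_power less_imp_le)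
          then have "\<epsilon>\<^sup>2 \<le> \<epsilon>\<^sup>2 / 100 + \<epsilon>\<^sup>2 / 2"
            by (rule ennreal_le_iff[THEN iffD1, rotated]) simp
          then show False using \<epsilon> by simp
        qed
        then obtain j where j: "con V f i j" "\<epsilon>\<^sub>1 < x j" by blast
        then show ?thesis
          using \<epsilon>\<^sub>1 i by (intro bexI[of _ "{j}"]) (auto simp: comps0 size0 ennreal_less_iff)
      qed
      have b: "\<not> (\<exists>vs es. is_cycle (MG N \<omega> x t) vs es \<and> m \<subseteq> set vs)"
        if m: "m \<in> graph_components (MG N \<omega> (trunc_le \<epsilon>\<^sub>1 x) 0)" for m
      proof
        assume "\<exists>vs es. is_cycle (MG N \<omega> x t) vs es \<and> m \<subseteq> set vs"
        then obtain vs es where c: "is_cycle (count_graph V f x) vs es" "m \<subseteq> set vs"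
          by (auto simp: MG f_def)
        obtain k where k: "k \<in> H" "m = {k}" using m by (auto simp: comps0 trunc_le_def H_def split: if_splits)
        have "f (k, k) = 0" using E2[OF \<omega>E k(1)] le_funD[OF fg, of "(k, k)"] by (simp add: g_def Count)
        then show False using cycle_count_graph[OF c(1), of k] c(2) k no by auto
      qed
      have cc: "\<exists>\<^sub>\<le>\<^sub>1 e. joins (MG N \<omega> x t) e m m'"
        if m: "m \<in> graph_components (MG N \<omega> (trunc_le \<epsilon>\<^sub>1 x) t)"
          "m' \<in> graph_components (MG N \<omega> (trunc_gt \<epsilon>\<^sub>1 x) t)" for m m'
      proof -
        obtain a b where "a \<in> H" "m = {j. con H f a j}" "b \<in> B" "m' = {j. con B f b j}"
          using m by (auto simp: MG graph_components_count_graph f_def)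
        then show ?thesis
          unfolding MG(1) f_def[symmetric] using joins_unique_count_graph[OF V2V(3-5) _ _ no] by blast
      qed
      have d: "sum_sq (MG N \<omega> x t) - sum_sq (MG N \<omega> (trunc_gt \<epsilon>\<^sub>2 x) t) \<le> ennreal (2 * \<epsilon>\<^sub>1\<^sup>2)"
      proof -
        have "susc w V f \<le> susc w V2 f + ennreal (2 * \<epsilon>\<^sub>1\<^sup>2)"
          using order_trans[OF susc_le_susc_plus[OF V2V(1)] add_left_mono[OF thr]] .
        moreover have "susc w V2 f < \<infinity>"
          using susc_mono[OF V2V(1) order_refl] fin by (rule le_less_trans)
        ultimately show ?thesis
          by (auto simp: MG sum_sq_count_graph w f_def[symmetric] ennreal_minus_le_iff)
      qed
      have e: "comp_size (MG N \<omega> x t) (component_of (MG N \<omega> x t) i)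
             - comp_size (MG N \<omega> (trunc_gt \<epsilon>\<^sub>2 x) t) (component_of (MG N \<omega> (trunc_gt \<epsilon>\<^sub>2 x) t) i)
           < ennreal \<epsilon>\<^sub>1"
        if i: "{i} \<in> graph_components (MG N \<omega> x 0) \<and> comp_size (MG N \<omega> x 0) {i} > ennreal \<epsilon>\<^sub>1" for i
      proof -
        have xi: "\<epsilon>\<^sub>1 < x i" using i \<epsilon>\<^sub>1 by (simp add: size0 ennreal_less_iff)
        then have iV: "i \<in> V2" "i \<in> V" using \<epsilon>\<^sub>1 \<epsilon>\<^sub>2 by (auto simp: V_def V2_def)
        obtain d where d: "csize w V f i \<le> csize w V2 f i + d"
          "2 * w i * d \<le> (\<Sum>k. of_bool (k \<in> V - V2) * through_sum w V f k)"
          using csize_le_csize_plus[OF V2V(1) iV(1)] by blast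
        \<comment> \<open>The loss satisfies 2 * \<open>x i\<close> * \<open>d\<close> \<le> 2 *
          \<open>\<epsilon>\<^sub>1^2\<close>; the strict inequality
          \<open>\<epsilon>\<^sub>1 < x i\<close> makes the bound on \<open>d\<close>
          strict.\<close>
        have d_less: "d < ennreal \<epsilon>\<^sub>1"
        proof (rule ccontr)
          assume "\<not> ?thesis"
          then have "2 * w i * ennreal \<epsilon>\<^sub>1 \<le> 2 * w i * d" by (intro mult_left_mono) auto
          also have "\<dots> \<le> ennreal (2 * \<epsilon>\<^sub>1\<^sup>2)" using d(2) thr by (rule order_trans)
          finally have "ennreal (2 * x i * \<epsilon>\<^sub>1) \<le> ennreal (2 * \<epsilon>\<^sub>1\<^sup>2)"
            using x[of i] \<epsilon>\<^sub>1 by (simp add: w_def ennreal_mult)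
          then have "2 * x i * \<epsilon>\<^sub>1 \<le> 2 * \<epsilon>\<^sub>1\<^sup>2"
            by (rule ennreal_le_iff[THEN iffD1, rotated]) simp
          then show False using xi \<epsilon>\<^sub>1 by (simp add: power2_eq_square)
        qed
        \<comment> \<open>The square of this size is below the finite susceptibility, so the size
          can be subtracted.\<close>
        have "csize w V2 f i < \<infinity>"
        proof (rule ccontr)
          assume "\<not> ?thesis"
          then have "csize w V2 f i = \<infinity>" by (simp add: less_top[symmetric])
          then have "(csize w V2 f i)\<^sup>2 = \<infinity>" by (simp add: power2_eq_square ennreal_mult_top)
          then show False
            using csize_square_le_susc[of w V2 f i] susc_mono[OF V2V(1) order_refl, of w f] fin by (simp add: top_unique)
        qed
        then have "csize w V f i - csize w V2 f i \<le> d"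
          using d(1) by (auto simp: ennreal_minus_le_iff)
        then have "csize w V f i - csize w V2 f i < ennreal \<epsilon>\<^sub>1"
          using d_less by (rule le_less_trans)
        then show ?thesis
          using iV by (simp add: MG component_of_count_graph comp_size_count_graph w f_def[symmetric])
      qed
      show "(\<forall>C\<in>graph_components (MG N \<omega> x t). comp_size (MG N \<omega> x t) C > ennreal \<epsilon> \<longrightarrow>
           (\<exists>m\<in>graph_components (MG N \<omega> x 0). comp_size (MG N \<omega> x 0) m > ennreal \<epsilon>\<^sub>1 \<and> m \<subseteq> C)) \<and>
        (\<forall>m\<in>graph_components (MG N \<omega> (trunc_le \<epsilon>\<^sub>1 x) 0).
           \<not> (\<exists>vs es. is_cycle (MG N \<omega> x t) vs es \<and> m \<subseteq> set vs)) \<and>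
        (\<forall>m\<in>graph_components (MG N \<omega> (trunc_le \<epsilon>\<^sub>1 x) t). \<forall>m'\<in>graph_components (MG N \<omega> (trunc_gt \<epsilon>\<^sub>1 x) t).
           \<exists>\<^sub>\<le>\<^sub>1 e. joins (MG N \<omega> x t) e m m') \<and>
        sum_sq (MG N \<omega> x t) - sum_sq (MG N \<omega> (trunc_gt \<epsilon>\<^sub>2 x) t) \<le> ennreal (2 * \<epsilon>\<^sub>1\<^sup>2) \<and>
        (\<forall>i. {i} \<in> graph_components (MG N \<omega> x 0) \<and> comp_size (MG N \<omega> x 0) {i} > ennreal \<epsilon>\<^sub>1 \<longrightarrow>
           comp_size (MG N \<omega> x t) (component_of (MG N \<omega> x t) i)
             - comp_size (MG N \<omega> (trunc_gt \<epsilon>\<^sub>2 x) t) (component_of (MG N \<omega> (trunc_gt \<epsilon>\<^sub>2 x) t) i)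
           < ennreal \<epsilon>\<^sub>1)"
        using a b cc d e by (intro conjI ballI allI impI)
    qed
  qed
qed

end
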